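(* Let $K$ be a finite maximal diagonalizable subgroup of $G=\mathrm{PGL}(n,\mathbb{C})$ and let $W_G(K)$ be its Weyl group. Then $W_G(K)$ equals the isometry group of $(K,\langle\cdot,\cdot\rangle)$, and is generated by the set of transvections in it.
   Context: A subgroup of $\mathrm{PGL}(n,\mathbb{C})$ is diagonalizable if it is abelian and consists of semisimple elements; a maximal diagonalizable subgroup is one maximal with respect to inclusion among diagonalizable subgroups. The Weyl group is $W_G(K)=N_G(K)/K$; it acts on $K$ by conjugation, and since $Z_G(K)=K$ this action is faithful, so $W_G(K)$ is regarded as a subgroup of $\mathrm{Aut}(K)$. The pairing $\langle\cdot,\cdot\rangle:K\times K\to\mathbb{C}^\times$ is defined by: for $\sigma,\tau\in K$ with preimages $\tilde\sigma,\tilde\tau\in\mathrm{GL}(n,\mathbb{C})$, $\tilde\sigma\tilde\tau\tilde\sigma^{-1}\tilde\tau^{-1}=\langle\sigma,\tau\rangle I_n$ (independent of the choice of preimages). The isometry group of $(K,\langle\cdot,\cdot\rangle)$ is the group of automorphisms of $K$ preserving $\langle\cdot,\cdot\rangle$. Let $\omega_m=e^{2\pi i/m}$. For $\sigma\in K$, $\sigma\ne 1$, of order $m$, and $k\in\mathbb{Z}$, the transvection $s_{\sigma,k}:K\to K$ is defined by $s_{\sigma,k}(\tau)=\tau\sigma^{-kj}$, where $\langle\sigma,\tau\rangle=\omega_m^{j}$. *)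

theory Defs
  imports "HOL-Analysis.Analysis" "HOL-Algebra.Algebra"
begin

text \<open>The size n is \<open>CARD('n)\<close>, so matrices are elements of \<^typ>\<open>complex^'n^'n\<close>.\<close>

definition GL :: "(complex^'n^'n) monoid" where
  "GL = \<lparr>carrier = {A. invertible A}, mult = (**), one = mat 1\<rparr>"

definition scalars :: "(complex^'n^'n) set" where
  "scalars = {mat c | c. c \<noteq> 0}"

text \<open>Elements of \<open>PGL\<close> are cosets of the scalar matrices, so the preimages in \<open>GL\<close> of
  \<open>\<sigma>\<close> in \<open>PGL\<close> are exactly the matrices \<open>A \<in> \<sigma>\<close>.\<close>

definition PGL :: "(complex^'n^'n) set monoid" where
  "PGL = GL Mod scalars"

lemma mat_mult_nth: "(mat c ** (A :: complex^'n^'n)) $ i $ j = c * A $ i $ j"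
proof -
  have "(mat c ** A) $ i $ j = (\<Sum>k\<in>UNIV. if k = i then c * A $ k $ j else 0)"
    unfolding matrix_matrix_mult_def mat_def vec_lambda_beta
    by (rule sum.cong) auto
  then show ?thesis by simp
qed

lemma mult_mat_nth: "((A :: complex^'n^'n) ** mat c) $ i $ j = A $ i $ j * c"
proof -
  have "(A ** mat c) $ i $ j = (\<Sum>k\<in>UNIV. if k = j then A $ i $ k * c else 0)"
    unfolding matrix_matrix_mult_def mat_def vec_lambda_beta
    by (rule sum.cong) auto
  then show ?thesis by simp
qed

lemma mat_mult_mat: "mat a ** mat b = (mat (a * b) :: complex^'n^'n)"
  by (simp add: vec_eq_iff mat_mult_nth) (simp add: mat_def)

lemma mat_commute: "mat c ** (A :: complex^'n^'n) = A ** mat c"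
  by (simp add: vec_eq_iff mat_mult_nth mult_mat_nth mult.commute)

lemma invertible_mat: "c \<noteq> 0 \<Longrightarrow> invertible (mat c :: complex^'n^'n)"
  unfolding invertible_def by (rule exI[of _ "mat (inverse c)"]) (simp add: mat_mult_mat)

lemma group_GL: "group (GL :: (complex^'n^'n) monoid)"
proof (rule groupI)
  fix x :: "complex^'n^'n"
  assume "x \<in> carrier GL"
  then obtain y where "x ** y = mat 1" "y ** x = mat 1"
    by (auto simp: GL_def invertible_def)
  then show "\<exists>y\<in>carrier GL. y \<otimes>\<^bsub>GL\<^esub> x = \<one>\<^bsub>GL\<^esub>"
    by (auto simp: GL_def invertible_def)
qed (auto simp: GL_def invertible_mult matrix_mul_assoc invertible_mat)

lemma normal_scalars: "(scalars :: (complex^'n^'n) set) \<lhd> GL"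
proof -
  interpret group "GL :: (complex^'n^'n) monoid" by (rule group_GL)
  have inv_scalar: "inv\<^bsub>GL\<^esub> (mat c) = (mat (inverse c) :: complex^'n^'n)" if "c \<noteq> 0" for c
    by (rule inv_equality) (use that in \<open>auto simp: GL_def mat_mult_mat invertible_mat\<close>)
  have sub: "subgroup (scalars :: (complex^'n^'n) set) GL"
  proof (rule subgroupI)
    show "(scalars :: (complex^'n^'n) set) \<subseteq> carrier GL"
      by (auto simp: scalars_def GL_def invertible_mat)
    show "(scalars :: (complex^'n^'n) set) \<noteq> {}"
      using zero_neq_one by (auto simp: scalars_def)
  next
    fix a :: "complex^'n^'n" assume "a \<in> scalars"
    then obtain c where "a = mat c" "c \<noteq> 0" by (auto simp: scalars_def)
    then show "inv\<^bsub>GL\<^esub> a \<in> scalars"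
      by (auto simp: scalars_def inv_scalar intro!: exI[of _ "inverse c"])
  next
    fix a b :: "complex^'n^'n" assume "a \<in> scalars" "b \<in> scalars"
    then obtain c d where "a = mat c" "c \<noteq> 0" "b = mat d" "d \<noteq> 0" by (auto simp: scalars_def)
    then show "a \<otimes>\<^bsub>GL\<^esub> b \<in> scalars"
      by (auto simp: scalars_def GL_def mat_mult_mat intro!: exI[of _ "c * d"])
  qed
  have "x \<otimes>\<^bsub>GL\<^esub> h \<otimes>\<^bsub>GL\<^esub> inv\<^bsub>GL\<^esub> x \<in> scalars"
    if x: "x \<in> carrier GL" and h: "h \<in> scalars" for x h :: "complex^'n^'n"
  proof -
    have hc: "h \<in> carrier GL" using h subgroup.subset[OF sub] by auto
    have "x \<otimes>\<^bsub>GL\<^esub> h = h \<otimes>\<^bsub>GL\<^esub> x"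
      using h by (auto simp: scalars_def GL_def mat_commute)
    then have "x \<otimes>\<^bsub>GL\<^esub> h \<otimes>\<^bsub>GL\<^esub> inv\<^bsub>GL\<^esub> x = h"
      using x hc by (simp add: m_assoc)
    then show ?thesis using h by simp
  qed
  with sub show ?thesis by (simp add: normal_inv_iff)
qed

lemma group_PGL: "group (PGL :: (complex^'n^'n) set monoid)"
  unfolding PGL_def by (rule normal.factorgroup_is_group[OF normal_scalars])

definition diagonalizable_matrix :: "complex^'n^'n \<Rightarrow> bool" where
  "diagonalizable_matrix A \<longleftrightarrow>
     (\<exists>(P :: complex^'n^'n) (D :: complex^'n^'n). invertible P \<and> (\<forall>i j. i \<noteq> j \<longrightarrow> D $ i $ j = 0) \<and> A = P ** D ** matrix_inv P)"

text \<open>An element of \<open>PGL\<close> is semisimple iff its preimages in \<open>GL\<close> are, and over the complex numbers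
  a semisimple matrix is the same as a diagonalizable one.\<close>

definition semisimple :: "(complex^'n^'n) set \<Rightarrow> bool" where
  "semisimple \<sigma> \<longleftrightarrow> (\<forall>A\<in>\<sigma>. diagonalizable_matrix A)"

definition diagonalizable_subgroup :: "(complex^'n^'n) set set \<Rightarrow> bool" where
  "diagonalizable_subgroup H \<longleftrightarrow>
     subgroup H PGL \<and> (\<forall>\<sigma>\<in>H. \<forall>\<tau>\<in>H. \<sigma> \<otimes>\<^bsub>PGL\<^esub> \<tau> = \<tau> \<otimes>\<^bsub>PGL\<^esub> \<sigma>) \<and> (\<forall>\<sigma>\<in>H. semisimple \<sigma>)"

definition maximal_diagonalizable_subgroup :: "(complex^'n^'n) set set \<Rightarrow> bool" where
  "maximal_diagonalizable_subgroup K \<longleftrightarrow>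
     diagonalizable_subgroup K \<and> (\<forall>H. diagonalizable_subgroup H \<and> K \<subseteq> H \<longrightarrow> H = K)"

abbreviation PGL_sub :: "(complex^'n^'n) set set \<Rightarrow> (complex^'n^'n) set monoid" where
  "PGL_sub K \<equiv> PGL\<lparr>carrier := K\<rparr>"

definition weyl_group :: "(complex^'n^'n) set set \<Rightarrow> (complex^'n^'n) set set monoid" where
  "weyl_group K = (PGL_sub (normalizer PGL K)) Mod K"

text \<open>The automorphism of \<open>K\<close> given by a coset \<open>w\<close> in \<open>N(K)/K\<close>: conjugation by any representative
  \<open>g \<in> w\<close>; the choice is immaterial because \<open>K\<close> is abelian. As elements of \<open>AutoGroup\<close> are
  extensional functions, maps \<open>K \<Rightarrow> K\<close> are restricted to \<open>K\<close> here and below.\<close>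

definition weyl_action ::
    "(complex^'n^'n) set set \<Rightarrow> (complex^'n^'n) set set \<Rightarrow> (complex^'n^'n) set \<Rightarrow> (complex^'n^'n) set" where
  "weyl_action K w = (let g = (SOME g. g \<in> w) in
     (\<lambda>\<tau>\<in>K. g \<otimes>\<^bsub>PGL\<^esub> \<tau> \<otimes>\<^bsub>PGL\<^esub> inv\<^bsub>PGL\<^esub> g))"

definition weyl_automorphisms :: "(complex^'n^'n) set set \<Rightarrow> ((complex^'n^'n) set \<Rightarrow> (complex^'n^'n) set) set" where
  "weyl_automorphisms K = weyl_action K ` carrier (weyl_group K)"

definition pairing :: "(complex^'n^'n) set \<Rightarrow> (complex^'n^'n) set \<Rightarrow> complex" where
  "pairing \<sigma> \<tau> = (THE c. \<forall>A\<in>\<sigma>. \<forall>B\<in>\<tau>. A ** B ** matrix_inv A ** matrix_inv B = mat c)"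

lemma matrix_inv_props:
  assumes "invertible (A :: complex^'n^'n)"
  shows "A ** matrix_inv A = mat 1" "matrix_inv A ** A = mat 1"
  using assms someI_ex[of "\<lambda>B. A ** B = mat 1 \<and> B ** A = mat 1"]
  by (auto simp: invertible_def matrix_inv_def)

lemma PGL_elem:
  fixes \<sigma> :: "(complex^'n^'n) set"
  assumes "\<sigma> \<in> carrier PGL" "A \<in> \<sigma>"
  shows "invertible A" "\<sigma> = {mat c ** A | c. c \<noteq> 0}"
proof -
  obtain B where B: "invertible B" and s: "\<sigma> = {mat c ** B | c. c \<noteq> 0}"
    using assms(1)
    by (auto simp: PGL_def FactGroup_def RCOSETS_def r_coset_def GL_def scalars_def)
  obtain c where c: "c \<noteq> 0" "A = mat c ** B" using assms(2) s by auto
  show "invertible A" using B c by (auto intro: invertible_mult invertible_mat)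
  have "mat d ** A = mat (d * c) ** B" for d
    by (simp add: c matrix_mul_assoc mat_mult_mat)
  moreover have "mat d ** B = mat (d / c) ** A" for d
    using c by (simp add: matrix_mul_assoc mat_mult_mat)
  ultimately have "x \<in> \<sigma> \<longleftrightarrow> x \<in> {mat c ** A | c. c \<noteq> 0}" for x
  proof -
    have "\<exists>d. x = mat d ** A \<and> d \<noteq> 0" if x: "x = mat e ** B" "e \<noteq> 0" for e
      using x c(1) \<open>\<And>d. mat d ** B = mat (d / c) ** A\<close>[of e] by (intro exI[of _ "e / c"]) simp
    moreover have "\<exists>d. x = mat d ** B \<and> d \<noteq> 0" if x: "x = mat e ** A" "e \<noteq> 0" for e
      using x c(1) \<open>\<And>d. mat d ** A = mat (d * c) ** B\<close>[of e] by (intro exI[of _ "e * c"]) simp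
    ultimately show ?thesis unfolding s by blast
  qed
  then show "\<sigma> = {mat c ** A | c. c \<noteq> 0}" by blast
qed

lemma PGL_mult_mem:
  assumes "A \<in> \<sigma>" "B \<in> \<tau>"
  shows "A ** B \<in> \<sigma> \<otimes>\<^bsub>PGL\<^esub> \<tau>"
  using assms by (auto simp: PGL_def FactGroup_def set_mult_def GL_def)

text \<open>On commuting elements the definite description in \<open>pairing\<close> denotes.\<close>

lemma pairing_eq:
  fixes \<sigma> \<tau> :: "(complex^'n^'n) set"
  assumes st: "\<sigma> \<in> carrier PGL" "\<tau> \<in> carrier PGL"
    and comm: "\<sigma> \<otimes>\<^bsub>PGL\<^esub> \<tau> = \<tau> \<otimes>\<^bsub>PGL\<^esub> \<sigma>"
    and AB: "A \<in> \<sigma>" "B \<in> \<tau>"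
  shows "A ** B ** matrix_inv A ** matrix_inv B = mat (pairing \<sigma> \<tau>)"
proof -
  have inj: "c = d" if "(mat c :: complex^'n^'n) = mat d" for c d
    using arg_cong[OF that, of "\<lambda>M. M $ undefined $ undefined"] by (simp add: mat_def)
  have prod: "\<tau> \<otimes>\<^bsub>PGL\<^esub> \<sigma> \<in> carrier PGL"
    using st group_PGL by (metis monoid.m_closed group.is_monoid)
  have key: "A' ** B' ** matrix_inv A' ** matrix_inv B' = mat c \<longleftrightarrow> A' ** B' = mat c ** (B' ** A')"
    if "invertible A'" "invertible B'" for A' B' :: "complex^'n^'n" and c
  proof
    assume "A' ** B' ** matrix_inv A' ** matrix_inv B' = mat c"
    then have "mat c ** (B' ** A') = (A' ** B' ** matrix_inv A' ** matrix_inv B') ** (B' ** A')"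
      by simp
    also have "\<dots> = A' ** B' ** (matrix_inv A' ** (matrix_inv B' ** B') ** A')"
      by (simp only: matrix_mul_assoc)
    finally show "A' ** B' = mat c ** (B' ** A')"
      by (simp add: matrix_inv_props that)
  next
    assume "A' ** B' = mat c ** (B' ** A')"
    then have "A' ** B' ** matrix_inv A' ** matrix_inv B'
        = mat c ** (B' ** A') ** matrix_inv A' ** matrix_inv B'"
      by simp
    also have "\<dots> = mat c ** (B' ** (A' ** matrix_inv A') ** matrix_inv B')"
      by (simp only: matrix_mul_assoc)
    finally show "A' ** B' ** matrix_inv A' ** matrix_inv B' = mat c"
      by (simp add: matrix_inv_props that)
  qed
  have "A ** B \<in> \<tau> \<otimes>\<^bsub>PGL\<^esub> \<sigma>" "B ** A \<in> \<tau> \<otimes>\<^bsub>PGL\<^esub> \<sigma>"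
    using PGL_mult_mem[OF AB] PGL_mult_mem[OF AB(2,1)] comm by auto
  then obtain c where c: "A ** B = mat c ** (B ** A)"
    using PGL_elem(2)[of "\<tau> \<otimes>\<^bsub>PGL\<^esub> \<sigma>" "B ** A", OF prod] by blast
  have all: "\<forall>A'\<in>\<sigma>. \<forall>B'\<in>\<tau>. A' ** B' ** matrix_inv A' ** matrix_inv B' = mat c"
  proof (intro ballI)
    fix A' B' assume A': "A' \<in> \<sigma>" and B': "B' \<in> \<tau>"
    obtain a b where ab: "A' = mat a ** A" "B' = mat b ** B"
      using PGL_elem(2)[OF st(1) AB(1)] PGL_elem(2)[OF st(2) AB(2)] A' B' by blast
    have swap: "(mat e ** M) ** (mat f ** N) = mat (e * f) ** (M ** N)"
      for e f and M N :: "complex^'n^'n"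
    proof -
      have "(mat e ** M) ** (mat f ** N) = mat e ** (M ** mat f) ** N"
        by (simp only: matrix_mul_assoc)
      also have "\<dots> = mat e ** (mat f ** M) ** N" by (simp only: mat_commute[of f M])
      also have "\<dots> = (mat e ** mat f) ** (M ** N)" by (simp only: matrix_mul_assoc)
      finally show ?thesis by (simp only: mat_mult_mat)
    qed
    have "A' ** B' = (mat (a * b) ** mat c) ** (B ** A)"
      unfolding ab swap c by (simp only: matrix_mul_assoc)
    also have "\<dots> = (mat c ** mat (b * a)) ** (B ** A)"
      by (simp add: mat_mult_mat mult.commute mult.left_commute)
    also have "\<dots> = mat c ** (B' ** A')"
      unfolding ab swap by (simp only: matrix_mul_assoc)
    finally have "A' ** B' = mat c ** (B' ** A')" .
    then show "A' ** B' ** matrix_inv A' ** matrix_inv B' = mat c"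
      using key[OF PGL_elem(1)[OF st(1) A'] PGL_elem(1)[OF st(2) B']] by simp
  qed
  have "pairing \<sigma> \<tau> = c"
    unfolding pairing_def
  proof (rule the_equality)
    show "\<forall>A\<in>\<sigma>. \<forall>B\<in>\<tau>. A ** B ** matrix_inv A ** matrix_inv B = mat c" by (rule all)
  next
    fix d assume "\<forall>A\<in>\<sigma>. \<forall>B\<in>\<tau>. A ** B ** matrix_inv A ** matrix_inv B = mat d"
    then show "d = c" using all AB inj[of d c] by force
  qed
  then show ?thesis using all AB by auto
qed

definition isometries :: "(complex^'n^'n) set set \<Rightarrow> ((complex^'n^'n) set \<Rightarrow> (complex^'n^'n) set) set" where
  "isometries K =
     {\<phi> \<in> auto (PGL_sub K). \<forall>\<sigma>\<in>K. \<forall>\<tau>\<in>K. pairing (\<phi> \<sigma>) (\<phi> \<tau>) = pairing \<sigma> \<tau>}"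

definition root_unity :: "nat \<Rightarrow> complex" where
  "root_unity m = exp (2 * of_real pi * \<i> / of_nat m)"

text \<open>The exponent \<open>j\<close> is determined only modulo the order of \<open>\<sigma>\<close>, hence so is \<open>k * j\<close>, and
  the value of the transvection does not depend on the choice.\<close>

definition transvection ::
    "(complex^'n^'n) set set \<Rightarrow> (complex^'n^'n) set \<Rightarrow> int \<Rightarrow> (complex^'n^'n) set \<Rightarrow> (complex^'n^'n) set" where
  "transvection K \<sigma> k = (\<lambda>\<tau>\<in>K.
     let j = (SOME j::int. pairing \<sigma> \<tau> = root_unity (group.ord PGL \<sigma>) powi j)
     in \<tau> \<otimes>\<^bsub>PGL\<^esub> (\<sigma> [^]\<^bsub>PGL\<^esub> (- k * j)))"

definition transvections :: "(complex^'n^'n) set set \<Rightarrow> ((complex^'n^'n) set \<Rightarrow> (complex^'n^'n) set) set" where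
  "transvections K = {transvection K \<sigma> k | \<sigma> k. \<sigma> \<in> K \<and> \<sigma> \<noteq> \<one>\<^bsub>PGL\<^esub>}"

end

theory Submission
  imports Defs "HOL-Computational_Algebra.Fundamental_Theorem_Algebra"
begin

text \<open>
  Let \<open>K\<close> be a finite maximal diagonalizable subgroup of \<open>PGL\<close>. Call the matrices in \<open>\<Union>K\<close> the lifts of
  \<open>K\<close>. Any two of them commute up to a scalar, which is the value of the pairing.

  The lifts act irreducibly. If an idempotent \<open>P\<close> commutes with all lifts, then so does \<open>1 + t P\<close> for every
  \<open>t \<noteq> -1\<close>; together with \<open>K\<close> these matrices generate a diagonalizable subgroup, so maximality puts
  them in \<open>K\<close>, and finiteness forces \<open>P = 0\<close> or \<open>P = 1\<close> (\<open>idempotent_trivial\<close>). Averaging over \<open>K\<close> as in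
  Maschke's theorem turns this into irreducibility and Schur's lemma (\<open>lift_irreducible\<close>, \<open>schur\<close>). Two
  consequences follow. The pairing is nondegenerate, because an element of its radical has a scalar lift.
  And \<open>K\<close> is its own centralizer in \<open>PGL\<close> (\<open>self_centralizing\<close>): the averaging operator has an explicit
  form, which shows that a matrix is determined by the traces of its products with the lifts, and
  these traces all vanish for a matrix that commutes up to scalars with the lifts without being one of
  them. Hence the Weyl group acts faithfully on \<open>K\<close>, and conjugation preserves the pairing.

  It remains to see that all isometries come from the Weyl group and that transvections generate. Both
  follow from two facts.

  The first is pure group theory: in a finite abelian group with a nondegenerate alternating pairing,
  every isometry is a product of transvections \<open>s\<^sub>x = s\<^sub>x\<^sub>,\<^sub>1\<close> (\<open>isoms_eq_transv_group\<close>). As in the case of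
  a symplectic vector space, one moves the images of a hyperbolic pair back by transvections and passes
  to the orthogonal complement of the pair. The point, which makes this work for cyclic factors of
  different orders, is to take a pair of elements whose order is the exponent \<open>m\<close> of the group:
  if \<open>u\<^sup>m = v\<^sup>m = 1\<close> and the pairing of \<open>u\<close> and \<open>v\<close> is a primitive \<open>m\<close>-th root of unity, then some
  transvection along \<open>u v\<^sup>-\<^sup>1\<close> maps \<open>u\<close> to \<open>v\<close> (\<open>transvection_between\<close>).

  The second is a matrix computation: the transvection along \<open>\<sigma>\<close> is conjugation by the quadratic Gauss
  sum \<open>\<Sum>\<^sub>r z\<^bsup>r(r+m)\<^esup> A\<^sup>r\<close>, where \<open>A\<close> is a lift of \<open>\<sigma>\<close> with \<open>A\<^sup>m = 1\<close> and \<open>z = exp (2 \<pi> i / 2m)\<close>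
  (\<open>transvection_in_weyl\<close>).

  So the isometry group is contained in the group generated by the transvections \<open>s\<^sub>x\<close>, that
  group in the image of the Weyl group, and the latter in the isometry group; the three are equal.
\<close>

section \<open>Roots of unity and exponents of finite abelian groups\<close>

lemma root_unity_nonzero [simp]: "root_unity m \<noteq> 0"
  by (simp add: root_unity_def)

lemma root_unity_powi_eq_1:
  assumes "m > 0"
  shows "root_unity m powi i = 1 \<longleftrightarrow> int m dvd i"
proof -
  have "root_unity m powi i = exp (of_int i * (2 * of_real pi * \<i> / of_nat m))"
    by (simp add: root_unity_def exp_power_int)
  also have "\<dots> = 1 \<longleftrightarrow> (\<exists>n::int. of_int i * (2 * pi / real m) = of_int (2 * n) * pi)"
    by (subst exp_eq_1) (auto simp: Re_divide_of_nat Im_divide_of_nat)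
  also have "\<dots> \<longleftrightarrow> (\<exists>n::int. real_of_int i = of_int (int m * n))"
    using assms by (auto simp: field_simps)
  also have "\<dots> \<longleftrightarrow> int m dvd i"
    unfolding of_int_eq_iff by (auto simp: dvd_def)
  finally show ?thesis .
qed

lemma root_unity_powi_eq_iff:
  assumes "m > 0"
  shows "root_unity m powi i = root_unity m powi j \<longleftrightarrow> int m dvd i - j"
proof -
  have "root_unity m powi i = root_unity m powi j \<longleftrightarrow> root_unity m powi (i - j) = 1"
    by (simp add: power_int_diff)
  then show ?thesis using root_unity_powi_eq_1[OF assms] by simp
qed

lemma root_of_1_eq_root_unity_powi:
  assumes "m > 0" "z ^ m = 1"
  obtains i :: int where "z = root_unity m powi i"
proof -
  obtain j where j: "z = exp (2 * of_real pi * \<i> * of_nat j / of_nat m)"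
    using complex_roots_unity[of m] assms by auto
  have "z = root_unity m powi int j"
    unfolding root_unity_def exp_power_int j by (simp add: field_simps)
  then show ?thesis using that by blast
qed

lemma (in comm_group) ord_mult_coprime:
  assumes x: "x \<in> carrier G" and y: "y \<in> carrier G" and cop: "coprime (ord x) (ord y)"
  shows "ord (x \<otimes> y) = ord x * ord y"
proof -
  have "(x \<otimes> y) [^] n = \<one> \<longleftrightarrow> ord x * ord y dvd n" for n :: nat
  proof
    assume n: "(x \<otimes> y) [^] n = \<one>"
    have "x [^] (n * ord y) \<otimes> y [^] (n * ord y) = \<one>"
      using n x y by (metis nat_pow_distrib m_closed nat_pow_pow nat_pow_one)
    moreover have "y [^] (n * ord y) = \<one>" "x [^] (n * ord x) = \<one>"
      using x y by (simp_all add: pow_eq_id)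
    moreover have "x [^] (n * ord x) \<otimes> y [^] (n * ord x) = \<one>"
      using n x y by (metis nat_pow_distrib m_closed nat_pow_pow nat_pow_one)
    ultimately have "ord x dvd n * ord y" "ord y dvd n * ord x"
      using x y by (simp_all add: pow_eq_id[symmetric])
    then have "ord x dvd n" "ord y dvd n"
      using cop by (auto simp: coprime_dvd_mult_left_iff coprime_commute)
    then show "ord x * ord y dvd n" using cop by (simp add: divides_mult)
  next
    assume "ord x * ord y dvd n"
    then have "ord x dvd n" "ord y dvd n" by (auto elim: dvd_mult_left dvd_mult_right)
    then show "(x \<otimes> y) [^] n = \<one>" using x y by (simp add: nat_pow_distrib pow_eq_id[symmetric])
  qed
  then show ?thesis using ord_unique x y by auto
qed

text \<open>An element of maximal order does it: if the order of \<open>h\<close> did not divide the order of \<open>s\<close>, some prime \<open>p\<close>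
  would occur to a higher power in the former, and replacing the \<open>p\<close>-part of \<open>s\<close> by that of \<open>h\<close> would
  give an element of larger order.\<close>
lemma (in comm_group) ex_exponent_element:
  assumes H: "subgroup H G" and fin: "finite (carrier G)"
  obtains s where "s \<in> H" "\<And>h. h \<in> H \<Longrightarrow> ord h dvd ord s"
proof -
  have sub: "H \<subseteq> carrier G" using H by (rule subgroup.subset)
  have finH: "finite (ord ` H)" "ord ` H \<noteq> {}"
    using sub fin finite_subset subgroup.one_closed[OF H] by (blast, blast)
  obtain s where s: "s \<in> H" "ord s = Max (ord ` H)" using Max_in[OF finH] by auto
  have max: "ord h \<le> ord s" if "h \<in> H" for h using that s finH by auto
  have pos: "ord h > 0" if "h \<in> H" for h using ord_ge_1[OF fin, of h] that sub by auto
  have "ord h dvd ord s" if h: "h \<in> H" for h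
  proof (rule ccontr)
    assume "\<not> ord h dvd ord s"
    then obtain p where p: "Factorial_Ring.prime p" "multiplicity p (ord s) < multiplicity p (ord h)"
      using multiplicity_le_imp_dvd[of "ord h" "ord s"] pos[OF h] by (metis gr_implies_not0 not_le)
    define k l where "k = multiplicity p (ord h)" and "l = multiplicity p (ord s)"
    obtain a where a: "ord s = p ^ l * a" "\<not> p dvd a"
      using multiplicity_decompose'[of "ord s" p] pos[OF s(1)] p(1) unfolding l_def
      by (metis not_prime_unit gr_implies_not0)
    obtain b where b: "ord h = p ^ k * b" "\<not> p dvd b"
      using multiplicity_decompose'[of "ord h" p] pos[OF h] p(1) unfolding k_def
      by (metis not_prime_unit gr_implies_not0)
    have p0: "p > 0" using p(1) prime_gt_0_nat by blast
    have ab: "a > 0" "b > 0" using pos s(1) h a b by (metis gr0I mult_0_right less_nat_zero_code)+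
    define x y where "x = s [^] (p ^ l)" and "y = h [^] b"
    have xy: "x \<in> H" "y \<in> H"
      unfolding x_def y_def using H s(1) h
      by (metis subgroup_int_pow_closed int_pow_int)+
    have "ord x = a" "ord y = p ^ k"
      unfolding x_def y_def using ord_pow[of s "p ^ l"] ord_pow[of h b] s(1) h sub a b ab p0 by auto
    moreover have "coprime a (p ^ k)"
      using prime_imp_coprime[OF p(1) a(2)] by (simp add: coprime_power_right_iff coprime_commute)
    ultimately have "ord (x \<otimes> y) = a * p ^ k"
      using ord_mult_coprime[of x y] xy sub by auto
    moreover have "a * p ^ k > a * p ^ l"
      using p(2) ab prime_gt_1_nat[OF p(1)] by (simp add: k_def l_def power_strict_increasing)
    ultimately show False using max[of "x \<otimes> y"] xy H a by (simp add: subgroup.m_closed mult.commute)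
  qed
  with s(1) show ?thesis using that by blast
qed

section \<open>Isometries and transvections of a finite abelian group with an alternating pairing\<close>

text \<open>The multiplicative analogue of a symplectic vector space. Cyclic factors of different
  orders may occur.\<close>
locale symplectic_group = comm_group +
  fixes B :: "'a \<Rightarrow> 'a \<Rightarrow> complex"
  assumes finite_carrier: "finite (carrier G)"
    and B_mult_left: "\<lbrakk>x \<in> carrier G; y \<in> carrier G; z \<in> carrier G\<rbrakk> \<Longrightarrow> B (x \<otimes> y) z = B x z * B y z"
    and B_mult_right: "\<lbrakk>x \<in> carrier G; y \<in> carrier G; z \<in> carrier G\<rbrakk> \<Longrightarrow> B x (y \<otimes> z) = B x y * B x z"
    and B_self: "x \<in> carrier G \<Longrightarrow> B x x = 1"
    and nondegenerate: "\<lbrakk>x \<in> carrier G; \<And>y. y \<in> carrier G \<Longrightarrow> B x y = 1\<rbrakk> \<Longrightarrow> x = \<one>"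
begin

lemma B_swap_mult: 
  assumes "x \<in> carrier G" "y \<in> carrier G" shows "B x y * B y x = 1"
proof -
  have "1 = B (x \<otimes> y) (x \<otimes> y)" using assms by (simp add: B_self)
  also have "\<dots> = B x x * B x y * (B y x * B y y)"
    using assms by (simp only: B_mult_left B_mult_right m_closed mult_ac)
  finally show ?thesis using assms by (simp add: B_self)
qed

lemma B_nonzero [simp]: "x \<in> carrier G \<Longrightarrow> y \<in> carrier G \<Longrightarrow> B x y \<noteq> 0"
  using B_swap_mult[of x y] by auto

lemma B_swap: "x \<in> carrier G \<Longrightarrow> y \<in> carrier G \<Longrightarrow> B y x = inverse (B x y)"
  using inverse_unique[OF B_swap_mult[of x y]] by simp

lemma B_one_left [simp]: "y \<in> carrier G \<Longrightarrow> B \<one> y = 1"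
  using B_mult_left[of \<one> \<one> y] by simp

lemma B_one_right [simp]: "y \<in> carrier G \<Longrightarrow> B y \<one> = 1"
  using B_mult_right[of y \<one> \<one>] by simp

lemma B_pow_left: "x \<in> carrier G \<Longrightarrow> y \<in> carrier G \<Longrightarrow> B (x [^] (n::nat)) y = B x y ^ n"
  by (induction n) (simp_all add: B_mult_left)

lemma B_inv_left: "x \<in> carrier G \<Longrightarrow> y \<in> carrier G \<Longrightarrow> B (inv x) y = inverse (B x y)"
  using inverse_unique[of "B x y" "B (inv x) y"] B_mult_left[of x "inv x" y] by simp

lemma B_int_pow_left: "x \<in> carrier G \<Longrightarrow> y \<in> carrier G \<Longrightarrow> B (x [^] (i::int)) y = B x y powi i"
  by (cases i rule: int_cases3)
    (simp_all add: int_pow_int int_pow_neg_int B_inv_left B_pow_left power_int_minus)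

lemma B_int_pow_right: "x \<in> carrier G \<Longrightarrow> y \<in> carrier G \<Longrightarrow> B x (y [^] (i::int)) = B x y powi i"
  by (metis B_int_pow_left B_swap int_pow_closed power_int_inverse)

lemma ord_pos: "x \<in> carrier G \<Longrightarrow> ord x > 0"
  using ord_ge_1[OF finite_carrier, of x] by simp

lemma B_log:
  assumes "x \<in> carrier G" "y \<in> carrier G" "x [^] (m::nat) = \<one>" "m > 0"
  obtains i :: int where "B x y = root_unity m powi i"
  using root_of_1_eq_root_unity_powi[OF assms(4), of "B x y"] B_pow_left[of x y m] assms by auto

definition isoms :: "('a \<Rightarrow> 'a) set" where
  "isoms = {\<phi> \<in> auto G. \<forall>x\<in>carrier G. \<forall>y\<in>carrier G. B (\<phi> x) (\<phi> y) = B x y}"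

text \<open>The transvection along \<open>x\<close>, with the same choice of exponent as in \<^const>\<open>transvection\<close>, so that the two
  agree definitionally on a subgroup of \<open>PGL\<close>.\<close>
definition transv :: "'a \<Rightarrow> int \<Rightarrow> 'a \<Rightarrow> 'a" where
  "transv x k = (\<lambda>y\<in>carrier G.
     let j = (SOME j::int. B x y = root_unity (ord x) powi j) in y \<otimes> x [^] (- k * j))"

lemma transv_eq:
  assumes x: "x \<in> carrier G" and y: "y \<in> carrier G" and j: "B x y = root_unity (ord x) powi j"
  shows "transv x k y = y \<otimes> x [^] (- k * j)"
proof -
  define i where "i = (SOME i::int. B x y = root_unity (ord x) powi i)"
  have "B x y = root_unity (ord x) powi i" unfolding i_def using j by (rule someI)
  then have "int (ord x) dvd j - i"
    using j root_unity_powi_eq_iff[OF ord_pos[OF x]] by metis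
  then have "int (ord x) dvd - k * j - - k * i" by (metis dvd_mult right_diff_distrib)
  then have "x [^] (- k * i) = x [^] (- k * j)" using x by (simp add: int_pow_eq)
  then show ?thesis using y unfolding transv_def i_def by (simp add: Let_def)
qed

lemma transv_cases:
  assumes "x \<in> carrier G" "y \<in> carrier G"
  obtains j where "B x y = root_unity (ord x) powi j" "\<And>k. transv x k y = y \<otimes> x [^] (- k * j)"
  using B_log[OF assms pow_ord_eq_1[OF assms(1)] ord_pos[OF assms(1)]] transv_eq[OF assms] by metis

lemma transv_closed: "x \<in> carrier G \<Longrightarrow> y \<in> carrier G \<Longrightarrow> transv x k y \<in> carrier G"
  by (metis transv_cases int_pow_closed m_closed)

lemma transv_orthogonal: "x \<in> carrier G \<Longrightarrow> y \<in> carrier G \<Longrightarrow> B x y = 1 \<Longrightarrow> transv x k y = y"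
  using transv_eq[of x y 0 k] by simp

lemma transv_mult:
  assumes "x \<in> carrier G" "y \<in> carrier G" "z \<in> carrier G"
  shows "transv x k (y \<otimes> z) = transv x k y \<otimes> transv x k z"
proof -
  obtain j where j: "B x y = root_unity (ord x) powi j" "transv x k y = y \<otimes> x [^] (- k * j)"
    using transv_cases assms by metis
  obtain i where i: "B x z = root_unity (ord x) powi i" "transv x k z = z \<otimes> x [^] (- k * i)"
    using transv_cases assms by metis
  have "B x (y \<otimes> z) = root_unity (ord x) powi (j + i)"
    using assms i j by (simp add: B_mult_right power_int_add)
  then have "transv x k (y \<otimes> z) = y \<otimes> z \<otimes> x [^] (- k * (j + i))"
    using transv_eq assms by simp
  also have "- k * (j + i) = - k * j + - k * i" by (simp add: algebra_simps)
  finally show ?thesis unfolding j i using assms by (simp only: int_pow_mult) (simp add: m_ac)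
qed

lemma transv_isometric:
  assumes "x \<in> carrier G" "y \<in> carrier G" "z \<in> carrier G"
  shows "B (transv x k y) (transv x k z) = B y z"
proof -
  obtain j where j: "B x y = root_unity (ord x) powi j" "transv x k y = y \<otimes> x [^] (- k * j)"
    using transv_cases assms by metis
  obtain i where i: "B x z = root_unity (ord x) powi i" "transv x k z = z \<otimes> x [^] (- k * i)"
    using transv_cases assms by metis
  have "B (transv x k y) (transv x k z) =
      B y z * (inverse (root_unity (ord x) powi j)) powi (- k * i) * (root_unity (ord x) powi i) powi (- k * j)"
    unfolding j(2) i(2) using assms
    by (simp add: B_mult_left B_mult_right B_int_pow_left B_int_pow_right B_self B_swap[of x y] j(1) i(1))
  also have "\<dots> = B y z"
    by (simp add: power_int_inverse flip: power_int_mult) (simp add: mult_ac flip: power_int_minus power_int_add)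
  finally show ?thesis .
qed

text \<open>Nondegeneracy makes an isometric endomorphism injective, and finiteness makes it surjective.\<close>
lemma isometric_bij:
  assumes \<phi>: "\<phi> \<in> hom G G" and iso: "\<And>x y. x \<in> carrier G \<Longrightarrow> y \<in> carrier G \<Longrightarrow> B (\<phi> x) (\<phi> y) = B x y"
  shows "bij_betw \<phi> (carrier G) (carrier G)"
proof -
  have "x = \<one>" if "x \<in> carrier G" "\<phi> x = \<one>" for x
  proof (rule nondegenerate[OF that(1)])
    fix y assume y: "y \<in> carrier G"
    then show "B x y = 1" using iso[of x y] that hom_in_carrier[OF \<phi> y] by simp
  qed
  then have "inj_on \<phi> (carrier G)"
    using \<phi> group_axioms by (subst inj_on_one_iff'[of _ G G]) auto
  then show ?thesis
    using finite_carrier \<phi> endo_inj_surj[of "carrier G" \<phi>] by (auto simp: bij_betw_def hom_def)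
qed

lemma transv_isom: "x \<in> carrier G \<Longrightarrow> transv x k \<in> isoms"
proof -
  assume x: "x \<in> carrier G"
  have hom: "transv x k \<in> hom G G"
    by (rule homI) (simp_all add: transv_closed transv_mult x)
  moreover have "transv x k \<in> extensional (carrier G)" by (simp add: transv_def)
  ultimately show ?thesis
    using isometric_bij[OF hom] transv_isometric[OF x] by (auto simp: isoms_def auto_def Bij_def)
qed

lemma AutoGroup_mult: "f \<in> auto G \<Longrightarrow> g \<in> auto G \<Longrightarrow> f \<otimes>\<^bsub>AutoGroup G\<^esub> g = compose (carrier G) f g"
  by (auto simp: AutoGroup_def BijGroup_def auto_def)

lemma carrier_AutoGroup: "carrier (AutoGroup G) = auto G"
  by (simp add: AutoGroup_def)

lemma one_AutoGroup: "\<one>\<^bsub>AutoGroup G\<^esub> = (\<lambda>x\<in>carrier G. x)"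
  by (simp add: AutoGroup_def BijGroup_def)

lemma isom_subset_auto: "isoms \<subseteq> auto G"
  by (auto simp: isoms_def)

lemma auto_closed: "f \<in> auto G \<Longrightarrow> x \<in> carrier G \<Longrightarrow> f x \<in> carrier G"
  by (auto simp: auto_def hom_def)

lemma auto_mult: "f \<in> auto G \<Longrightarrow> x \<in> carrier G \<Longrightarrow> y \<in> carrier G \<Longrightarrow> f (x \<otimes> y) = f x \<otimes> f y"
  by (auto simp: auto_def hom_def)

text \<open>Only the transvections with \<open>k = 1\<close> are taken as generators, because these are the ones realised
  by Gauss sums; \<open>transv_in_transv_group\<close> recovers the others as their powers.\<close>
definition transv_group :: "('a \<Rightarrow> 'a) set" where
  "transv_group = generate (AutoGroup G) {transv x 1 | x. x \<in> carrier G \<and> x \<noteq> \<one>}"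

lemma transv_group_subgroup: "subgroup transv_group (AutoGroup G)"
  unfolding transv_group_def
  by (rule group.generate_is_subgroup[OF AutoGroup]) (use transv_isom isom_subset_auto in \<open>auto simp: carrier_AutoGroup\<close>)

lemma transv_group_auto: "t \<in> transv_group \<Longrightarrow> t \<in> auto G"
  using subgroup.subset[OF transv_group_subgroup] by (auto simp: carrier_AutoGroup)

lemma transv_group_compose: "s \<in> transv_group \<Longrightarrow> t \<in> transv_group \<Longrightarrow> compose (carrier G) s t \<in> transv_group"
  using subgroup.m_closed[OF transv_group_subgroup, of s t] by (simp add: AutoGroup_mult transv_group_auto)

text \<open>This allows an isometry to be modified by transvections in a proof that it lies in \<open>transv_group\<close>.\<close>
lemma transv_group_isom_compose:
  assumes "t \<in> transv_group" "\<phi> \<in> isoms"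
  shows "compose (carrier G) t \<phi> \<in> transv_group \<longleftrightarrow> \<phi> \<in> transv_group"
proof
  interpret A: group "AutoGroup G" by (rule AutoGroup)
  have \<phi>: "\<phi> \<in> carrier (AutoGroup G)" using assms by (simp add: isoms_def carrier_AutoGroup)
  have t: "t \<in> carrier (AutoGroup G)" using assms by (simp add: transv_group_auto carrier_AutoGroup)
  assume "compose (carrier G) t \<phi> \<in> transv_group"
  then have "t \<otimes>\<^bsub>AutoGroup G\<^esub> \<phi> \<in> transv_group"
    using \<phi> t by (simp add: AutoGroup_mult carrier_AutoGroup)
  from subgroup.m_closed[OF transv_group_subgroup subgroup.m_inv_closed[OF transv_group_subgroup assms(1)] this]
  show "\<phi> \<in> transv_group" using \<phi> t by (simp flip: A.m_assoc)
qed (rule transv_group_compose[OF assms(1)])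

lemma transv_0: "x \<in> carrier G \<Longrightarrow> transv x 0 = \<one>\<^bsub>AutoGroup G\<^esub>"
  unfolding one_AutoGroup transv_def by (rule restrict_ext) simp

lemma transv_add:
  assumes x: "x \<in> carrier G"
  shows "transv x (k + l) = compose (carrier G) (transv x k) (transv x l)"
proof
  fix y
  show "transv x (k + l) y = compose (carrier G) (transv x k) (transv x l) y"
  proof (cases "y \<in> carrier G")
    case True
    obtain j where j: "B x y = root_unity (ord x) powi j" "\<And>k. transv x k y = y \<otimes> x [^] (- k * j)"
      using transv_cases x True by metis
    have "B x (transv x l y) = root_unity (ord x) powi j"
      unfolding j(2) using x True by (simp add: B_mult_right B_int_pow_right B_self j(1))
    then have "transv x k (transv x l y) = y \<otimes> x [^] (- l * j) \<otimes> x [^] (- k * j)"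
      using transv_eq[of x "transv x l y" j k] x True transv_closed j(2) by simp
    also have "\<dots> = y \<otimes> x [^] (- l * j + - k * j)"
      using x True by (simp only: int_pow_mult m_assoc int_pow_closed)
    also have "- l * j + - k * j = - (k + l) * j" by (simp add: algebra_simps)
    finally show ?thesis using True j(2)[of "k + l"] by (simp only: compose_eq)
  qed (simp add: transv_def compose_def)
qed

lemma transv_cong: 
  assumes x: "x \<in> carrier G" and "int (ord x) dvd k - l" shows "transv x k = transv x l"
proof
  fix y
  show "transv x k y = transv x l y"
  proof (cases "y \<in> carrier G")
    case True
    obtain j where j: "\<And>k. transv x k y = y \<otimes> x [^] (- k * j)"
      using transv_cases x True by metis
    have "int (ord x) dvd - l * j - - k * j"
      using assms(2) by (metis dvd_mult2 left_diff_distrib minus_diff_minus dvd_minus_iff minus_diff_eq)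
    then have "x [^] (- k * j) = x [^] (- l * j)" using x by (simp add: int_pow_eq)
    then show ?thesis by (simp only: j)
  qed (simp add: transv_def)
qed

lemma transv_in_transv_group:
  assumes x: "x \<in> carrier G"
  shows "transv x k \<in> transv_group"
proof (cases "x = \<one>")
  case True
  then have "transv x k = \<one>\<^bsub>AutoGroup G\<^esub>"
    using transv_cong[OF x, of k 0] transv_0[OF x] by simp
  then show ?thesis using subgroup.one_closed[OF transv_group_subgroup] by simp
next
  case False
  then have 1: "transv x 1 \<in> transv_group" unfolding transv_group_def using x by (blast intro: generate.incl)
  have nat: "transv x (int n) \<in> transv_group" for n
  proof (induction n)
    case 0
    show ?case using subgroup.one_closed[OF transv_group_subgroup] transv_0[OF x] by simp
  next
    case (Suc n)
    then show ?case using transv_add[OF x, of 1 "int n"] transv_group_compose[OF 1] by simp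
  qed
  have "transv x k = transv x (int (nat (k mod int (ord x))))"
    using ord_pos[OF x] by (intro transv_cong[OF x]) (simp add: mod_eq_dvd_iff[symmetric])
  then show ?thesis using nat by metis
qed

section \<open>Transitivity of the transvection group\<close>

definition orth :: "'a set \<Rightarrow> 'a set" where
  "orth H = {f \<in> carrier G. \<forall>h\<in>H. B h f = 1}"

lemma orth_carrier: "f \<in> orth H \<Longrightarrow> f \<in> carrier G"
  by (simp add: orth_def)

lemma orth_right: "f \<in> orth H \<Longrightarrow> h \<in> H \<Longrightarrow> B h f = 1"
  by (simp add: orth_def)

text \<open>Take \<open>x = u v\<^sup>-\<^sup>1\<close>. Its pairing with \<open>u\<close> is the pairing of \<open>u\<close> and \<open>v\<close>, which has order \<open>m\<close>, so \<open>x\<close> has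
  order \<open>m\<close> as well. The transvection with parameter \<open>k\<close> sends \<open>u\<close> to \<open>u x\<^bsup>-ki\<^esup>\<close>, which is \<open>u x\<^sup>-\<^sup>1 = v\<close>
  when \<open>k\<close> inverts \<open>i\<close> modulo \<open>m\<close>. It fixes everything orthogonal to \<open>x\<close>.\<close>
lemma transvection_between:
  assumes u: "u \<in> carrier G" and v: "v \<in> carrier G" and m: "u [^] m = \<one>" "v [^] m = \<one>" "m > 0"
    and i: "B u v = root_unity m powi i" "coprime i (int m)"
  obtains t where "t \<in> transv_group" "t u = v" "\<And>f. f \<in> carrier G \<Longrightarrow> B u f = B v f \<Longrightarrow> t f = f"
proof -
  define x where "x = u \<otimes> inv v"
  have x: "x \<in> carrier G" unfolding x_def using u v by simp
  have Bx: "B x f = B u f * inverse (B v f)" if "f \<in> carrier G" for f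
    unfolding x_def using u v that by (simp add: B_mult_left B_inv_left)
  have Bxu: "B x u = root_unity m powi i"
    using u v Bx[of u] B_swap[of u v] by (simp add: B_self i)
  have "x [^] m = \<one>" unfolding x_def using u v m by (simp add: nat_pow_distrib nat_pow_inv)
  then have "ord x dvd m" using x by (simp add: pow_eq_id)
  moreover have "m dvd ord x"
  proof -
    have "B (x [^] ord x) u = 1" using x u by simp
    then have "root_unity m powi (i * int (ord x)) = 1"
      using x u by (simp only: B_pow_left Bxu power_int_mult power_int_of_nat)
    then have "int m dvd i * int (ord x)" using m(3) by (simp only: root_unity_powi_eq_1)
    then show ?thesis using i(2) by (simp add: coprime_dvd_mult_right_iff coprime_commute)
  qed
  ultimately have ordx: "ord x = m" by (rule dvd_antisym)
  obtain k l where "k * i + l * int m = 1" using bezout_int[of i "int m"] i(2) by auto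
  then have "(- 1) - (- k * i) = int m * (- l)" by (simp add: algebra_simps)
  then have "int m dvd (- 1) - (- k * i)" by simp
  then have "x [^] (- k * i) = x [^] (- 1 :: int)" using x ordx by (simp only: int_pow_eq)
  then have "x [^] (- k * i) = inv x" using x by (simp add: int_pow_neg)
  then have "transv x k u = u \<otimes> inv x" using transv_eq[OF x u, of i k] Bxu ordx by simp
  also have "\<dots> = v" unfolding x_def using u v by (simp add: inv_mult m_assoc[symmetric])
  finally have "transv x k u = v" .
  moreover have "transv x k f = f" if "f \<in> carrier G" "B u f = B v f" for f
    using transv_orthogonal[OF x that(1)] Bx[OF that(1)] that v by simp
  ultimately show ?thesis using that transv_in_transv_group[OF x] by blast
qed

text \<open>The exponents of the values of the pairing with \<open>u\<close> form a subgroup of the integers, generated by some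
  divisor \<open>g\<close> of the order \<open>m\<close> of \<open>u\<close>. Then \<open>u\<^bsup>m/g\<^esup>\<close> is orthogonal to \<open>H\<close>, hence trivial, so \<open>g = 1\<close>.\<close>
lemma ex_partner:
  assumes H: "subgroup H G" and nd: "H \<inter> orth H \<subseteq> {\<one>}"
    and u: "u \<in> H"
  obtains y where "y \<in> H" "B u y = root_unity (ord u)"
proof -
  define m where "m = ord u"
  have sub: "h \<in> carrier G" if "h \<in> H" for h using subgroup.subset[OF H] that by blast
  have m: "m > 0" unfolding m_def using ord_pos sub u by blast
  define J where "J = {j::int. \<exists>y\<in>H. B u y = root_unity m powi j}"
  have Jlin: "a + c * b \<in> J" if ab: "a \<in> J" "b \<in> J" for a b c
  proof -
    obtain y z where y: "y \<in> H" "B u y = root_unity m powi a" and z: "z \<in> H" "B u z = root_unity m powi b"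
      using ab unfolding J_def by blast
    have "B u (y \<otimes> z [^] c) = root_unity m powi (a + c * b)"
      using u y z sub by (simp add: B_mult_right B_int_pow_right power_int_add power_int_mult[symmetric] mult.commute)
    moreover have "y \<otimes> z [^] c \<in> H" using y z H by (simp add: subgroup.m_closed subgroup_int_pow_closed)
    ultimately show ?thesis unfolding J_def by blast
  qed
  have mJ: "int m \<in> J" unfolding J_def
    using subgroup.one_closed[OF H] u sub m root_unity_powi_eq_1[OF m, of "int m"] by force
  define g where "g = (LEAST n. n > 0 \<and> int n \<in> J)"
  have g: "g > 0" "int g \<in> J"
    using LeastI[of "\<lambda>n. n > 0 \<and> int n \<in> J" m] m mJ unfolding g_def by auto
  have gdvd: "int g dvd j" if "j \<in> J" for j
  proof (rule ccontr)
    assume "\<not> int g dvd j"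
    then have "nat (j mod int g) > 0" "nat (j mod int g) < g" using g(1)
      by (simp_all add: dvd_eq_mod_eq_0 pos_mod_sign order.not_eq_order_implies_strict nat_less_iff)
    moreover have "j mod int g \<in> J"
      using Jlin[OF that g(2), of "- (j div int g)"] by (simp add: minus_div_mult_eq_mod)
    ultimately show False
      using not_less_Least[of "nat (j mod int g)" "\<lambda>n. n > 0 \<and> int n \<in> J"] g(1) unfolding g_def by simp
  qed
  have "g dvd m" using gdvd[OF mJ] by simp
  then obtain q where q: "m = g * q" ..
  have uq: "u [^] q \<in> H" using subgroup_int_pow_closed[OF H u, of "int q"] by (simp add: int_pow_int)
  moreover have "B h (u [^] q) = 1" if h: "h \<in> H" for h
  proof -
    obtain j where j: "B u h = root_unity m powi j"
      using B_log[of u h m] u h sub m pow_ord_eq_1 unfolding m_def by metis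
    then have "int g dvd j" using gdvd h unfolding J_def by blast
    then have "int m dvd j * int q" unfolding q by (auto simp: dvd_def)
    then have "B (u [^] q) h = 1"
      using u h sub root_unity_powi_eq_1[OF m, of "j * int q"] by (simp add: B_pow_left j power_int_mult)
    then show ?thesis using B_swap[of "u [^] q" h] sub h uq by simp
  qed
  ultimately have "u [^] q = \<one>" using nd sub uq unfolding orth_def by blast
  then have "m dvd q" using u sub pow_eq_id unfolding m_def by blast
  moreover have q0: "q > 0" using q m by (cases q) auto
  ultimately have "g * q \<le> 1 * q" using dvd_imp_le q by simp
  then have "g = 1" using q0 g(1) by (simp only: mult_le_cancel2) simp
  then show ?thesis using g(2) that unfolding J_def m_def by auto
qed

text \<open>The stepping stone between two elements of order \<open>m\<close>. The exponents of the pairings of \<open>u\<close> and \<open>v\<close> with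
  \<open>w\<close> must avoid all primes dividing \<open>m\<close>. For one prime \<open>p\<close> this is possible since a group is not the
  union of two proper subgroups: one of a partner \<open>y\<close> of \<open>u\<close>, a partner \<open>z\<close> of \<open>v\<close>, and \<open>y z\<close>
  works. The primes are then treated one after the other, as in the Chinese remainder theorem.\<close>
lemma ex_common_partner:
  assumes H: "subgroup H G" and nd: "H \<inter> orth H \<subseteq> {\<one>}"
    and u: "u \<in> H" "ord u = m" and v: "v \<in> H" "ord v = m"
  obtains w i j where "w \<in> H" "B u w = root_unity m powi i" "B v w = root_unity m powi j"
    "coprime i (int m)" "coprime j (int m)"
proof -
  have sub: "h \<in> carrier G" if "h \<in> H" for h using subgroup.subset[OF H] that by blast
  have m: "m > 0" using ord_pos sub u by blast
  obtain y where y: "y \<in> H" "B u y = root_unity m" using ex_partner[OF H nd u(1)] u by metis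
  obtain z where z: "z \<in> H" "B v z = root_unity m" using ex_partner[OF H nd v(1)] v by metis
  define good where "good p w i j \<longleftrightarrow> w \<in> H \<and> B u w = root_unity m powi i \<and> B v w = root_unity m powi j
    \<and> \<not> int p dvd i \<and> \<not> int p dvd j" for p w i j
  have good_comb: "B x (w \<otimes> w') = root_unity m powi (i + i')"
    if "x \<in> H" "w \<in> H" "w' \<in> H" "B x w = root_unity m powi i" "B x w' = root_unity m powi i'" for x w w' i i'
    using that sub by (simp add: B_mult_right power_int_add)
  have one: "\<exists>w i j. good p w i j" if p: "Factorial_Ring.prime p" for p :: nat
  proof -
    obtain a where a: "B v y = root_unity m powi a"
      using B_log[of v y m] v y sub m pow_ord_eq_1 by metis
    obtain b where b: "B u z = root_unity m powi b"
      using B_log[of u z m] u z sub m pow_ord_eq_1 by metis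
    have p1: "\<not> int p dvd 1" using p not_prime_unit by auto
    have yz: "y \<otimes> z \<in> H" using y z H by (simp add: subgroup.m_closed)
    consider "\<not> int p dvd a" | "\<not> int p dvd b" | "int p dvd a" "int p dvd b" by blast
    then show ?thesis
    proof cases
      case 1
      then have "good p y 1 a" unfolding good_def using y a p1 by simp
      then show ?thesis by blast
    next
      case 2
      then have "good p z b 1" unfolding good_def using z b p1 by simp
      then show ?thesis by blast
    next
      case 3
      have "good p (y \<otimes> z) (1 + b) (a + 1)" unfolding good_def
        using yz good_comb[OF u(1) y(1) z(1), of 1 b] good_comb[OF v(1) y(1) z(1), of a 1] y z a b 3 p1
        by (simp add: dvd_add_left_iff dvd_add_right_iff)
      then show ?thesis by blast
    qed
  qed
  have "\<exists>w i j. w \<in> H \<and> B u w = root_unity m powi i \<and> B v w = root_unity m powi j \<and>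
      (\<forall>p\<in>S. \<not> int p dvd i \<and> \<not> int p dvd j)" if "finite S" "\<forall>p\<in>S. Factorial_Ring.prime p" for S :: "nat set"
    using that
  proof (induction S rule: finite_induct)
    case empty
    obtain a where "B v y = root_unity m powi a"
      using B_log[of v y m] v y sub m pow_ord_eq_1 by metis
    moreover have "B u y = root_unity m powi 1" using y(2) by simp
    ultimately show ?case using y(1) by blast
  next
    case (insert p S)
    then obtain w i j where w: "w \<in> H" "B u w = root_unity m powi i" "B v w = root_unity m powi j"
      "\<forall>p\<in>S. \<not> int p dvd i \<and> \<not> int p dvd j" by auto
    obtain w' i' j' where w': "good p w' i' j'" using one insert.prems by blast
    define N where "N = (\<Prod>q\<in>S. int q)"
    have pp: "Factorial_Ring.prime (int p)" using insert.prems by simp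
    have pN: "\<not> int p dvd N"
    proof
      assume "int p dvd N"
      then obtain q where "q \<in> S" "int p dvd int q" unfolding N_def using prime_dvd_prod_iff[OF insert.hyps(1) pp] by blast
      then have "p dvd q" by simp
      then have "p = q" using \<open>q \<in> S\<close> insert.prems primes_dvd_imp_eq[of p q] by blast
      then show False using \<open>q \<in> S\<close> insert.hyps by simp
    qed
    have qN: "int q dvd N" if "q \<in> S" for q unfolding N_def using insert.hyps that by (simp add: dvd_prodI)
    have qp: "\<not> int q dvd int p" if "q \<in> S" for q
      using that insert.prems insert.hyps primes_dvd_imp_eq[of q p] by auto
    \<comment> \<open>The first factor decides divisibility by the primes in \<open>S\<close>, the second divisibility by \<open>p\<close>.\<close>
    define W where "W = w [^] int p \<otimes> w' [^] N"
    have powB: "B x (h [^] c) = root_unity m powi (c * e)"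
      if "x \<in> H" "h \<in> H" "B x h = root_unity m powi e" for x h c e
      using that sub by (simp add: B_int_pow_right power_int_mult[symmetric] mult.commute)
    have WH: "W \<in> H" "w [^] int p \<in> H" "w' [^] N \<in> H"
      unfolding W_def using w w' H by (simp_all add: good_def subgroup.m_closed subgroup_int_pow_closed)
    have BW: "B u W = root_unity m powi (int p * i + N * i')" "B v W = root_unity m powi (int p * j + N * j')"
      unfolding W_def using w w' WH u v good_comb powB by (auto simp: good_def)
    have ndvd: "\<not> int q dvd int p * e + N * e'"
      if "q \<in> insert p S" "q \<in> S \<Longrightarrow> \<not> int q dvd e" "\<not> int p dvd e'" for q e e'
    proof (cases "q = p")
      case True
      then show ?thesis using pN that(3) pp by (simp add: dvd_add_right_iff prime_dvd_mult_iff)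
    next
      case False
      then have "q \<in> S" "Factorial_Ring.prime (int q)" using that insert.prems by auto
      then show ?thesis using qN[of q] qp[of q] that(2) by (simp add: dvd_add_left_iff prime_dvd_mult_iff)
    qed
    have "\<forall>q\<in>insert p S. \<not> int q dvd int p * i + N * i' \<and> \<not> int q dvd int p * j + N * j'"
    proof (intro ballI conjI)
      fix q assume q: "q \<in> insert p S"
      show "\<not> int q dvd int p * i + N * i'" by (rule ndvd[OF q]) (use w(4) w' in \<open>auto simp: good_def\<close>)
      show "\<not> int q dvd int p * j + N * j'" by (rule ndvd[OF q]) (use w(4) w' in \<open>auto simp: good_def\<close>)
    qed
    with BW WH(1) show ?case by blast
  qed
  from this[of "prime_factors m"] obtain w i j where w: "w \<in> H" "B u w = root_unity m powi i" "B v w = root_unity m powi j"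
      "\<forall>p\<in>prime_factors m. \<not> int p dvd i \<and> \<not> int p dvd j" by auto
  have cop: "coprime e (int m)" if e: "\<forall>p\<in>prime_factors m. \<not> int p dvd e" for e
  proof (rule ccontr)
    assume "\<not> coprime e (int m)"
    then obtain c where c: "c dvd e" "c dvd int m" "\<not> is_unit c" by (rule not_coprimeE)
    have "c \<noteq> 0" using c(2) m by auto
    then obtain b where b: "b dvd c" "Factorial_Ring.prime b" using prime_divisor_exists[of c] c(3) by blast
    define p where "p = nat b"
    have "int p = b" using b(2) prime_ge_0_int unfolding p_def by simp
    then have "Factorial_Ring.prime p" "int p dvd e" "p dvd m"
      using b(2) dvd_trans[OF b(1) c(1)] dvd_trans[OF b(1) c(2)] by auto
    then show False using e m by (auto simp: prime_factors_dvd)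
  qed
  show ?thesis using that[OF w(1-3)] cop w(4) by blast
qed

text \<open>Two steps, \<open>u\<close> to \<open>w\<close> and \<open>w\<close> to \<open>v\<close>, through a common partner \<open>w\<close>. Since \<open>m\<close> is the exponent of \<open>H\<close>, the
  element \<open>w\<close> satisfies the hypothesis \<open>w\<^sup>m = 1\<close> of \<open>transvection_between\<close>.\<close>
lemma transitive_on_exponent_elements:
  assumes H: "subgroup H G" and nd: "H \<inter> orth H \<subseteq> {\<one>}"
    and u: "u \<in> H" "ord u = m" and v: "v \<in> H" "ord v = m" and exp: "\<forall>h\<in>H. h [^] m = \<one>"
  obtains t where "t \<in> transv_group" "t u = v" "\<forall>f\<in>orth H. t f = f"
proof -
  have sub: "h \<in> carrier G" if "h \<in> H" for h using subgroup.subset[OF H] that by blast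
  have m: "m > 0" using ord_pos sub u by blast
  obtain w i j where w: "w \<in> H" "B u w = root_unity m powi i" "B v w = root_unity m powi j"
    "coprime i (int m)" "coprime j (int m)" using ex_common_partner[OF H nd u v] by blast
  obtain s where s: "s \<in> transv_group" "s u = w" "\<And>f. f \<in> carrier G \<Longrightarrow> B u f = B w f \<Longrightarrow> s f = f"
    using transvection_between[of u w m i] u w sub exp m by metis
  have "B w v = root_unity m powi (- j)" using B_swap[of v w] v w sub by (simp add: power_int_minus)
  then obtain t where t: "t \<in> transv_group" "t w = v" "\<And>f. f \<in> carrier G \<Longrightarrow> B w f = B v f \<Longrightarrow> t f = f"
    using transvection_between[of w v m "- j"] v w sub exp m by (metis coprime_minus_left_iff)
  show ?thesis
  proof
    show "compose (carrier G) t s \<in> transv_group" using s t transv_group_compose by blast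
    show "compose (carrier G) t s u = v" using s t u sub by (simp add: compose_eq)
    show "\<forall>f\<in>orth H. compose (carrier G) t s f = f"
      using s(3) t(3) u(1) v(1) w(1) by (simp add: compose_eq orth_carrier orth_right)
  qed
qed

text \<open>A transvection along \<open>s\<close> fixes \<open>s\<close> and multiplies \<open>y\<close> by any prescribed power of \<open>s\<close>; this adjusts the
  pairing with \<open>z\<close> to the generator \<open>root_unity m\<close>. Then \<open>transvection_between\<close> applies, and the
  transvection it provides fixes \<open>s\<close> because \<open>s\<close> pairs equally with both elements.\<close>
lemma transitive_on_partners:
  assumes H: "subgroup H G" and exp: "\<forall>h\<in>H. h [^] m = \<one>"
    and s: "s \<in> H" "ord s = m" and y: "y \<in> H" "B s y = root_unity m" and z: "z \<in> H" "B s z = root_unity m"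
  obtains t where "t \<in> transv_group" "t s = s" "t y = z" "\<forall>f\<in>orth H. t f = f"
proof -
  have sub: "h \<in> carrier G" if "h \<in> H" for h using subgroup.subset[OF H] that by blast
  have m: "m > 0" using ord_pos sub s by blast
  obtain b where b: "B y z = root_unity m powi b" using B_log[of y z m] y z sub m exp by metis
  define x where "x = y \<otimes> s [^] (1 - b)"
  have x: "x \<in> H" unfolding x_def using H y s by (simp add: subgroup.m_closed subgroup_int_pow_closed)
  define t1 where "t1 = transv s (b - 1)"
  have sc: "s \<in> carrier G" and yc: "y \<in> carrier G" using s y sub by auto
  have t1: "t1 \<in> transv_group" "t1 s = s" "\<And>f. f \<in> carrier G \<Longrightarrow> B s f = 1 \<Longrightarrow> t1 f = f"
    unfolding t1_def using sc transv_in_transv_group transv_orthogonal B_self by auto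
  have t1y: "t1 y = x" unfolding t1_def x_def using transv_eq[of s y 1 "b - 1"] s y sub by simp
  have "B x z = root_unity m powi b * root_unity m powi (1 - b)"
    unfolding x_def using s y z sub b by (simp add: B_mult_left B_int_pow_left)
  then have "B x z = root_unity m powi 1" by (simp flip: power_int_add)
  then obtain t2 where t2: "t2 \<in> transv_group" "t2 x = z" "\<And>f. f \<in> carrier G \<Longrightarrow> B x f = B z f \<Longrightarrow> t2 f = f"
    using transvection_between[of x z m 1] x z sub exp m by (metis coprime_1_left)
  have "B x s = B z s" unfolding x_def
    using s y z sub B_swap[of s y] B_swap[of s z] by (simp add: B_mult_left B_int_pow_left B_self)
  then have "t2 s = s" using t2(3) sc by blast
  show ?thesis
  proof
    show "compose (carrier G) t2 t1 \<in> transv_group" using t1 t2 transv_group_compose by blast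
    show "compose (carrier G) t2 t1 s = s" using t1 \<open>t2 s = s\<close> sc by (simp add: compose_eq)
    show "compose (carrier G) t2 t1 y = z" using t1y t2 yc by (simp add: compose_eq)
    show "\<forall>f\<in>orth H. compose (carrier G) t2 t1 f = f"
      using t1(3) t2(3) s(1) x z(1) by (simp add: compose_eq orth_carrier orth_right)
  qed
qed

section \<open>Isometries are products of transvections\<close>

text \<open>The shape of the induction: \<open>\<phi>\<close> is the identity on a complement of \<open>H\<close> that is orthogonal to \<open>H\<close>, so that
  only the part of \<open>\<phi>\<close> on \<open>H\<close> remains to be dealt with. The complement is described
  elementwise, by fixed elements orthogonal to \<open>H\<close>, so that no double orthogonal complements arise.\<close>
definition splits_off :: "('a \<Rightarrow> 'a) \<Rightarrow> 'a set \<Rightarrow> bool" where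
  "splits_off \<phi> H \<longleftrightarrow> (\<forall>k\<in>carrier G. \<exists>h\<in>H. \<exists>f\<in>orth H. k = h \<otimes> f \<and> \<phi> f = f)"

lemma splits_offE:
  assumes "splits_off \<phi> H" "k \<in> carrier G"
  obtains h f where "h \<in> H" "f \<in> orth H" "f \<in> carrier G" "k = h \<otimes> f" "\<phi> f = f"
  using assms unfolding splits_off_def by (metis orth_carrier)

lemma splits_nondegenerate:
  assumes "splits_off \<phi> H" "subgroup H G"
  shows "H \<inter> orth H \<subseteq> {\<one>}"
proof -
  have "h = \<one>" if h: "h \<in> H" "h \<in> orth H" for h
  proof (rule nondegenerate)
    show hc: "h \<in> carrier G" using h orth_carrier by blast
    fix k assume "k \<in> carrier G"
    with assms(1) obtain h' f where k: "h' \<in> H" "f \<in> orth H" "f \<in> carrier G" "k = h' \<otimes> f" by (rule splits_offE)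
    have h'c: "h' \<in> carrier G" using k(1) subgroup.subset[OF assms(2)] by blast
    have "B h h' = 1" using orth_right[OF h(2) k(1)] B_swap[OF h'c hc] by simp
    then show "B h k = 1" using orth_right[OF k(2) h(1)] hc h'c k by (simp add: B_mult_right)
  qed
  then show ?thesis by blast
qed

text \<open>The component \<open>f\<close> of \<open>\<phi> h\<close> in the complement is orthogonal to the fixed vectors \<open>f2\<close>, because \<open>\<phi>\<close> is isometric
  and \<open>h\<close> is orthogonal to them, and it is orthogonal to \<open>H\<close>; so it is trivial.\<close>
lemma splits_image:
  assumes \<phi>: "\<phi> \<in> isoms" and sp: "splits_off \<phi> H" and H: "subgroup H G" and h: "h \<in> H"
  shows "\<phi> h \<in> H"
proof -
  have sub: "h \<in> carrier G" if "h \<in> H" for h using subgroup.subset[OF H] that by blast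
  have "\<phi> h \<in> carrier G" using \<phi> h sub auto_closed isom_subset_auto by blast
  with sp obtain h' f where f: "h' \<in> H" "f \<in> orth H" "f \<in> carrier G" "\<phi> h = h' \<otimes> f" "\<phi> f = f" by (rule splits_offE)
  have "f = \<one>"
  proof (rule nondegenerate[OF f(3)])
    fix k assume "k \<in> carrier G"
    with sp obtain h2 f2 where k: "h2 \<in> H" "f2 \<in> orth H" "f2 \<in> carrier G" "k = h2 \<otimes> f2" "\<phi> f2 = f2"
      by (rule splits_offE)
    have "B f h2 = 1" using orth_right[OF f(2) k(1)] f(3) k(1) sub B_swap[of h2 f] by simp
    moreover have "B f f2 = 1"
    proof -
      have "B h f2 = B (\<phi> h) (\<phi> f2)" using \<phi> h k(3) sub unfolding isoms_def by simp
      also have "\<dots> = B h' f2 * B f f2" unfolding f(4) k(5) using f(1,3) k(3) sub by (simp add: B_mult_left)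
      finally show ?thesis using orth_right[OF k(2)] h f(1) by simp
    qed
    ultimately show "B f k = 1" using f(3) k sub by (simp add: B_mult_right)
  qed
  then show ?thesis using f(1,4) sub by simp
qed

lemma splits_compose:
  assumes "splits_off \<phi> H" "\<forall>f\<in>orth H. t f = f"
  shows "splits_off (compose (carrier G) t \<phi>) H"
  unfolding splits_off_def
proof
  fix k assume "k \<in> carrier G"
  with assms(1) obtain h f where k: "h \<in> H" "f \<in> orth H" "f \<in> carrier G" "k = h \<otimes> f" "\<phi> f = f" by (rule splits_offE)
  then have "compose (carrier G) t \<phi> f = f" using assms(2) by (simp add: compose_eq)
  with k show "\<exists>h\<in>H. \<exists>f\<in>orth H. k = h \<otimes> f \<and> compose (carrier G) t \<phi> f = f" by blast
qed

lemma subgroup_isoms: "subgroup isoms (AutoGroup G)"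
proof -
  interpret A: group "AutoGroup G" by (rule AutoGroup)
  show ?thesis
  proof (rule A.subgroupI)
    show "isoms \<subseteq> carrier (AutoGroup G)" using isom_subset_auto by (simp add: carrier_AutoGroup)
    show "isoms \<noteq> {}" using transv_isom[OF one_closed] by blast
  next
    fix f assume f: "f \<in> isoms"
    then have fa: "f \<in> auto G" using isom_subset_auto by blast
    define g where "g = inv\<^bsub>AutoGroup G\<^esub> f"
    have g: "g \<in> auto G" using fa A.inv_closed[of f] unfolding g_def carrier_AutoGroup by blast
    have "compose (carrier G) f g = (\<lambda>x\<in>carrier G. x)"
      using A.r_inv[of f] fa g unfolding g_def one_AutoGroup[symmetric] by (simp add: carrier_AutoGroup AutoGroup_mult)
    then have fg: "f (g x) = x" if "x \<in> carrier G" for x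
      using that by (metis compose_eq restrict_apply')
    have "B (g x) (g y) = B x y" if "x \<in> carrier G" "y \<in> carrier G" for x y
    proof -
      have "B (f (g x)) (f (g y)) = B (g x) (g y)" using f auto_closed[OF g] that unfolding isoms_def by blast
      then show ?thesis using fg that by simp
    qed
    then show "inv\<^bsub>AutoGroup G\<^esub> f \<in> isoms" using g unfolding isoms_def g_def by blast
  next
    fix f g assume fg: "f \<in> isoms" "g \<in> isoms"
    then have a: "f \<in> auto G" "g \<in> auto G" using isom_subset_auto by auto
    then have "compose (carrier G) f g \<in> auto G"
      using A.m_closed[of f g] by (simp add: carrier_AutoGroup AutoGroup_mult)
    then show "f \<otimes>\<^bsub>AutoGroup G\<^esub> g \<in> isoms"
      using fg a auto_closed by (simp add: AutoGroup_mult isoms_def compose_eq)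
  qed
qed

lemma transv_group_subset_isoms: "transv_group \<subseteq> isoms"
  unfolding transv_group_def
  by (rule group.generate_subgroup_incl[OF AutoGroup _ subgroup_isoms]) (use transv_isom in auto)

lemma isoms_compose:
  assumes "t \<in> transv_group" "\<phi> \<in> isoms" shows "compose (carrier G) t \<phi> \<in> isoms"
proof -
  have "t \<otimes>\<^bsub>AutoGroup G\<^esub> \<phi> \<in> isoms"
    using assms transv_group_subset_isoms subgroup.m_closed[OF subgroup_isoms] by blast
  then show ?thesis using assms transv_group_auto isom_subset_auto by (simp add: AutoGroup_mult subset_iff)
qed

text \<open>Induction on the size of \<open>H\<close>. Choose \<open>s\<close> in \<open>H\<close> whose order is the exponent \<open>m\<close> of \<open>H\<close>, and a partner \<open>y\<close>.
  Composing \<open>\<phi>\<close> with transvections along elements of \<open>H\<close>, which leave the fixed complement alone, makes it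
  fix \<open>s\<close> and then \<open>y\<close>. Now \<open>s\<close> and \<open>y\<close> can be moved into the complement, leaving the
  smaller subgroup \<open>H'\<close> of elements of \<open>H\<close> orthogonal to both.\<close>
lemma splitting_isometry_in_transv_group:
  assumes "subgroup H G" "\<phi> \<in> isoms" "splits_off \<phi> H"
  shows "\<phi> \<in> transv_group"
  using assms
proof (induction "card H" arbitrary: H \<phi> rule: less_induct)
  case less
  note H = less.prems(1)
  have sub: "h \<in> carrier G" if "h \<in> H" for h using subgroup.subset[OF H] that by blast
  have finH: "finite H" using finite_subset[OF subgroup.subset[OF H] finite_carrier] .
  note nd = splits_nondegenerate[OF less.prems(3) H]
  obtain s where s: "s \<in> H" "\<And>h. h \<in> H \<Longrightarrow> ord h dvd ord s"
    using ex_exponent_element[OF H finite_carrier] by blast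
  define m where "m = ord s"
  have m: "m > 0" unfolding m_def using s sub ord_pos by blast
  have exp: "\<forall>h\<in>H. h [^] m = \<one>" using s(2) sub by (simp add: pow_eq_id m_def)
  show ?case
  proof (cases "m = 1")
    case True
    have "\<phi> k = k" if "k \<in> carrier G" for k
    proof -
      from less.prems(3) that obtain h f where k: "h \<in> H" "f \<in> carrier G" "k = h \<otimes> f" "\<phi> f = f" by (rule splits_offE)
      have "h = \<one>" using exp k(1) sub True by simp
      then show ?thesis using k by simp
    qed
    moreover have "\<phi> \<in> extensional (carrier G)" using less.prems(2) by (simp add: isoms_def auto_def Bij_def)
    ultimately have "\<phi> = \<one>\<^bsub>AutoGroup G\<^esub>"
      unfolding one_AutoGroup by (intro extensionalityI[of _ "carrier G"]) auto
    then show ?thesis using subgroup.one_closed[OF transv_group_subgroup] by simp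
  next
    case False
    obtain y where y: "y \<in> H" "B s y = root_unity m" using ex_partner[OF H nd s(1)] m_def by metis
    have \<phi>s: "\<phi> s \<in> H" using splits_image[OF less.prems(2,3) H s(1)] .
    have "ord (\<phi> s) = m"
    proof (rule dvd_antisym)
      show "ord (\<phi> s) dvd m" using pow_eq_id[OF sub[OF \<phi>s], of m] exp \<phi>s by blast
      have \<phi>y: "\<phi> y \<in> carrier G" using splits_image[OF less.prems(2,3) H y(1)] sub by blast
      have "B (\<phi> s) (\<phi> y) = root_unity m" using less.prems(2) s(1) y sub unfolding isoms_def by simp
      then have "root_unity m ^ ord (\<phi> s) = 1"
        using B_pow_left[of "\<phi> s" "\<phi> y" "ord (\<phi> s)"] sub[OF \<phi>s] \<phi>y by simp
      then show "m dvd ord (\<phi> s)" using root_unity_powi_eq_1[OF m, of "int (ord (\<phi> s))"] by simp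
    qed
    then obtain t1 where t1: "t1 \<in> transv_group" "t1 (\<phi> s) = s"
      "\<forall>f\<in>orth H. t1 f = f"
      using transitive_on_exponent_elements[OF H nd \<phi>s _ s(1) _ exp] m_def by metis
    define \<phi>1 where "\<phi>1 = compose (carrier G) t1 \<phi>"
    have \<phi>1: "\<phi>1 \<in> isoms" "splits_off \<phi>1 H" "\<phi>1 s = s"
      unfolding \<phi>1_def using isoms_compose splits_compose less.prems t1 s sub by (auto simp: compose_eq)
    have \<phi>1y: "\<phi>1 y \<in> H" using splits_image[OF \<phi>1(1,2) H y(1)] .
    have "B s (\<phi>1 y) = B (\<phi>1 s) (\<phi>1 y)" by (simp add: \<phi>1)
    also have "\<dots> = root_unity m" using \<phi>1(1) s y sub unfolding isoms_def by simp
    finally obtain t2 where t2: "t2 \<in> transv_group" "t2 s = s" "t2 (\<phi>1 y) = y"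
      "\<forall>f\<in>orth H. t2 f = f"
      using transitive_on_partners[OF H exp s(1) _ \<phi>1y _ y] m_def by metis
    define \<phi>2 where "\<phi>2 = compose (carrier G) t2 \<phi>1"
    have \<phi>2: "\<phi>2 \<in> isoms" "splits_off \<phi>2 H" "\<phi>2 s = s" "\<phi>2 y = y"
      unfolding \<phi>2_def using isoms_compose splits_compose \<phi>1 t2 s y sub by (auto simp: compose_eq)
    have \<phi>2a: "\<phi>2 \<in> auto G" using \<phi>2 isom_subset_auto by blast
    define H' where "H' = {h \<in> H. B h s = 1 \<and> B h y = 1}"
    have sc: "s \<in> carrier G" and yc: "y \<in> carrier G" using s y sub by auto
    have H': "subgroup H' G"
    proof (rule subgroupI)
      show "H' \<noteq> {}" using subgroup.one_closed[OF H] sc yc B_one_left unfolding H'_def by blast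
    qed (use sub H sc yc in \<open>auto simp: H'_def B_mult_left B_inv_left subgroup.m_closed subgroup.m_inv_closed\<close>)
    have "s \<notin> H'" using y(2) root_unity_powi_eq_1[OF m, of 1] False m unfolding H'_def by auto
    then have card: "card H' < card H"
      using s(1) finH by (intro psubset_card_mono) (auto simp: H'_def)
    have sp: "splits_off \<phi>2 H'" unfolding splits_off_def
    proof
      fix k assume "k \<in> carrier G"
      with \<phi>2(2) obtain h f where k: "h \<in> H" "f \<in> orth H" "f \<in> carrier G" "k = h \<otimes> f" "\<phi>2 f = f"
        by (rule splits_offE)
      have hc: "h \<in> carrier G" using k sub by blast
      obtain a where a: "B h s = root_unity m powi a" using B_log[of h s m] hc sc exp k(1) m by blast
      obtain b where b: "B h y = root_unity m powi b" using B_log[of h y m] hc yc exp k(1) m by blast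
      \<comment> \<open>The component of \<open>h\<close> in the hyperbolic plane spanned by \<open>s\<close> and \<open>y\<close>: it has the same pairings with \<open>s\<close> and
        \<open>y\<close> as \<open>h\<close>.\<close>
      define e where "e = s [^] b \<otimes> y [^] (- a)"
      have ys: "B y s = inverse (root_unity m)" using B_swap[OF sc yc] y(2) by simp
      have eH: "e \<in> H" unfolding e_def using H s(1) y(1) by (simp add: subgroup.m_closed subgroup_int_pow_closed)
      have ec: "e \<in> carrier G" using eH sub by blast
      have es: "B e s = root_unity m powi a" unfolding e_def using sc yc
        by (simp add: B_mult_left B_int_pow_left B_self ys power_int_inverse power_int_minus)
      have ey: "B e y = root_unity m powi b" unfolding e_def using sc yc
        by (simp add: B_mult_left B_int_pow_left B_self y(2))
      have \<phi>e: "\<phi>2 e = e"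
        using hom_int_pow[of \<phi>2 G G] auto_mult[OF \<phi>2a] \<phi>2a \<phi>2 sc yc group_axioms
        unfolding e_def by (simp add: auto_def)
      have "h \<otimes> inv e \<in> H'" unfolding H'_def
        using k(1) eH H hc ec sc yc es ey a b by (simp add: B_mult_left B_inv_left subgroup.m_closed subgroup.m_inv_closed)
      moreover have "k = (h \<otimes> inv e) \<otimes> (e \<otimes> f)"
        using k hc ec by (simp add: m_assoc[symmetric]) (simp add: m_assoc)
      moreover have "e \<otimes> f \<in> orth H'"
        using k(2,3) sub ec sc yc unfolding H'_def e_def orth_def by (auto simp: B_mult_right B_int_pow_right)
      moreover have "\<phi>2 (e \<otimes> f) = e \<otimes> f" using auto_mult[OF \<phi>2a ec k(3)] \<phi>e k(5) by simp
      ultimately show "\<exists>h\<in>H'. \<exists>f\<in>orth H'. k = h \<otimes> f \<and> \<phi>2 f = f" by blast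
    qed
    have "\<phi>2 \<in> transv_group" using less.hyps[OF card H' \<phi>2(1) sp] .
    then show ?thesis
      using transv_group_isom_compose[OF t2(1) \<phi>1(1)] transv_group_isom_compose[OF t1(1) less.prems(2)]
      unfolding \<phi>2_def \<phi>1_def by simp
  qed
qed
theorem isoms_eq_transv_group: "isoms = transv_group"
proof
  show "transv_group \<subseteq> isoms" by (rule transv_group_subset_isoms)
  have "splits_off \<phi> (carrier G)" if "\<phi> \<in> isoms" for \<phi>
  proof -
    have "\<phi> \<one> = \<one>" using that hom_one[of \<phi> G G] group_axioms by (auto simp: isoms_def auto_def)
    moreover have "\<one> \<in> orth (carrier G)" by (simp add: orth_def)
    ultimately show ?thesis unfolding splits_off_def by (metis r_one)
  qed
  then show "isoms \<subseteq> transv_group" using splitting_isometry_in_transv_group[OF subgroup_self] by blast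
qed

end

section \<open>Complex matrices: eigenvalues, diagonalizability, projections\<close>

lemma mat_vector_mult: "mat c *v (v :: complex^'n) = c *s v"
proof -
  have "(mat c *v v) $ i = (\<Sum>k\<in>UNIV. if k = i then c * v $ k else 0)" for i
    unfolding matrix_vector_mult_def mat_def vec_lambda_beta by (rule sum.cong) auto
  then show ?thesis by (simp add: vec_eq_iff)
qed

lemma matrix_mult_add_left: "(A + B) ** C = A ** C + B ** (C :: complex^'n^'n)"
  by (simp add: vec_eq_iff matrix_matrix_mult_def distrib_right sum.distrib)

lemma matrix_mult_sum_distrib_left: "(\<Sum>i\<in>I. f i) ** A = (\<Sum>i\<in>I. f i ** (A :: complex^'n^'n))"
  by (induction I rule: infinite_finite_induct) (simp_all add: matrix_mult_add_left)

lemma matrix_mult_sum_distrib_right: "A ** (\<Sum>i\<in>I. f i) = (\<Sum>i\<in>I. (A :: complex^'n^'n) ** f i)"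
  by (induction I rule: infinite_finite_induct) (simp_all add: matrix_add_ldistrib)

lemma matrix_vector_mult_sum_distrib: "(\<Sum>i\<in>I. f i) *v v = (\<Sum>i\<in>I. (f i :: complex^'n^'n) *v v)"
  by (induction I rule: infinite_finite_induct) (simp_all add: matrix_vector_mult_add_rdistrib)

lemma trace_mat_mult: "trace (mat c ** A) = c * trace (A :: complex^'n^'n)"
  by (simp add: trace_def mat_mult_nth sum_distrib_left)

lemma trace_sum: "trace (\<Sum>i\<in>I. f i) = (\<Sum>i\<in>I. trace (f i :: complex^'n^'n))"
  by (induction I rule: infinite_finite_induct) (simp_all add: trace_add, simp_all add: trace_def)

lemma matrix_eqI_vec: "(\<And>v. A *v v = B *v v) \<Longrightarrow> A = (B :: complex^'n^'n)"
  by (simp add: matrix_eq)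

text \<open>The determinant of \<open>T - z\<close> is a polynomial \<open>p\<close> in \<open>z\<close>. If it had no zero it would be a constant \<open>c\<close>, and then
  the polynomial \<open>q\<close> given by the determinant of \<open>w T - 1\<close> would equal \<open>c w\<^sup>n\<close> for \<open>w \<noteq> 0\<close>, hence
  for all \<open>w\<close>; but its value at \<open>0\<close> is not \<open>0\<close>.\<close>
lemma ex_eigenvalue:
  fixes T :: "complex^'n^'n"
  shows "\<exists>z. \<not> invertible (T - mat z)"
proof (rule ccontr)
  assume "\<not> ?thesis"
  then have inv: "invertible (T - mat z)" for z by blast
  define n where "n = CARD('n)"
  define p :: "complex poly" where "p = (\<Sum>\<pi> | \<pi> permutes (UNIV :: 'n set). of_int (sign \<pi>) *
     (\<Prod>i\<in>UNIV. [: T $ i $ \<pi> i, - (if i = \<pi> i then 1 else 0) :]))"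
  define q :: "complex poly" where "q = (\<Sum>\<pi> | \<pi> permutes (UNIV :: 'n set). of_int (sign \<pi>) *
     (\<Prod>i\<in>UNIV. [: - (if i = \<pi> i then 1 else 0), T $ i $ \<pi> i :]))"
  have p: "poly p z = det (T - mat z)" for z
  proof -
    have "poly [: T $ i $ j, - (if i = j then 1 else 0) :] z = (T - mat z) $ i $ j" for i j
      by (simp add: mat_def)
    then show ?thesis
      by (simp only: p_def det_def poly_sum poly_mult poly_prod poly_of_int)
  qed
  have q: "poly q w = det (mat w ** T - mat 1)" for w
  proof -
    have "poly [: - (if i = j then 1 else 0), T $ i $ j :] w = (mat w ** T - mat 1) $ i $ j" for i j
      by (simp add: mat_mult_nth) (simp add: mat_def)
    then show ?thesis
      by (simp only: q_def det_def poly_sum poly_mult poly_prod poly_of_int)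
  qed
  have "poly p z \<noteq> 0" for z using inv[of z] unfolding p by (simp add: invertible_det_nz)
  then have "constant (poly p)" using fundamental_theorem_of_algebra by blast
  then obtain c where c: "\<And>z. det (T - mat z) = c" unfolding p[symmetric] constant_def by metis
  have "poly q w = c * w ^ n" if "w \<noteq> 0" for w
  proof -
    have "mat w ** T - mat 1 = mat w ** (T - mat (1 / w))"
      using that by (simp add: vec_eq_iff mat_mult_nth) (simp add: mat_def field_simps)
    moreover have "det (mat w :: complex^'n^'n) = w ^ n"
      by (subst det_diagonal) (simp_all add: mat_def n_def)
    ultimately show ?thesis unfolding q by (simp add: det_mul c)
  qed
  \<comment> \<open>Multiplying by the variable removes the exceptional point \<open>w = 0\<close>.\<close>
  then have "poly ([:0, 1:] * (q - Polynomial.monom c n)) w = 0" for w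
    by (cases "w = 0") (simp_all add: poly_monom)
  then have "[:0, 1:] * (q - Polynomial.monom c n) = 0" by (metis poly_all_0_iff_0)
  then have "q = Polynomial.monom c n" by simp
  then have "poly q 0 = 0" by (simp add: poly_monom n_def)
  moreover have "det (- mat 1 :: complex^'n^'n) \<noteq> 0"
  proof -
    have "- mat 1 = (mat (- 1) :: complex^'n^'n)" by (simp add: vec_eq_iff mat_def)
    moreover have "invertible (mat (- 1) :: complex^'n^'n)" by (rule invertible_mat) simp
    ultimately have "invertible (- mat 1 :: complex^'n^'n)" by simp
    then show ?thesis by (simp add: invertible_det_nz)
  qed
  ultimately show False unfolding q by simp
qed

lemma diagonalizable_matrix_iff:
  fixes A :: "complex^'n^'n"
  shows "diagonalizable_matrix A \<longleftrightarrow> vec.span {v. \<exists>c. A *v v = c *s v} = UNIV"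
proof
  assume "diagonalizable_matrix A"
  then obtain P D :: "complex^'n^'n" where P: "invertible P" and D: "\<And>i j. i \<noteq> j \<Longrightarrow> D $ i $ j = 0"
    and A: "A = P ** D ** matrix_inv P"
    unfolding diagonalizable_matrix_def by blast
  have AP: "A ** P = P ** D"
    unfolding A by (simp add: matrix_mul_assoc[symmetric] matrix_inv_props[OF P])
  have "A *v column j P = D $ j $ j *s column j P" for j
  proof -
    have "(A *v column j P) $ i = (A ** P) $ i $ j" for i
      by (simp add: matrix_vector_mult_def matrix_matrix_mult_def column_def)
    moreover have "(P ** D) $ i $ j = (\<Sum>k\<in>UNIV. if k = j then P $ i $ k * D $ k $ j else 0)" for i
      unfolding matrix_matrix_mult_def vec_lambda_beta by (rule sum.cong) (auto simp: D)
    ultimately show ?thesis by (simp add: vec_eq_iff AP column_def)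
  qed
  then have "columns P \<subseteq> {v. \<exists>c. A *v v = c *s v}" by (auto simp: columns_def)
  moreover have "vec.span (columns P) = UNIV"
    using matrix_right_invertible_span_columns P matrix_inv_props by blast
  ultimately show "vec.span {v. \<exists>c. A *v v = c *s v} = UNIV"
    using vec.span_mono by blast
next
  assume span: "vec.span {v. \<exists>c. A *v v = c *s v} = UNIV"
  obtain S where S: "S \<subseteq> {v. \<exists>c. A *v v = c *s v}" "vec.independent S"
    "{v. \<exists>c. A *v v = c *s v} \<subseteq> vec.span S"
    using vec.maximal_independent_subset by blast
  have spanS: "vec.span S = UNIV"
    using span S(3) vec.span_mono vec.span_span by blast
  then have "card S = CARD('n)" using vec.dim_eq_card[OF _ S(2), of UNIV] vec_dim_card[where 'a = complex and 'n = 'n] by simp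
  then obtain f :: "'n \<Rightarrow> complex^'n" where f: "bij_betw f UNIV S"
    using finite_same_card_bij[of "UNIV :: 'n set" S] vec.finiteI_independent[OF S(2)] by auto
  have "\<exists>c. A *v f j = c *s f j" for j using f S(1) by (auto simp: bij_betw_def)
  then obtain c where c: "\<And>j. A *v f j = c j *s f j" by metis
  define P :: "complex^'n^'n" where "P = (\<chi> i j. f j $ i)"
  define D :: "complex^'n^'n" where "D = (\<chi> i j. if i = j then c j else 0)"
  have col: "column j P = f j" for j by (simp add: P_def column_def)
  then have "columns P = S" using f by (auto simp: columns_def bij_betw_def)
  then have P: "invertible P"
    using spanS matrix_right_invertible_span_columns invertible_right_inverse by metis
  have "A ** P = P ** D"
  proof -
    have "(A ** P) $ i $ j = (A *v f j) $ i" for i j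
      by (simp add: matrix_matrix_mult_def matrix_vector_mult_def P_def)
    moreover have "(P ** D) $ i $ j = (\<Sum>k\<in>UNIV. if k = j then f k $ i * c k else 0)" for i j
      unfolding matrix_matrix_mult_def P_def D_def vec_lambda_beta by (rule sum.cong) auto
    ultimately show ?thesis by (simp add: vec_eq_iff c mult.commute)
  qed
  then have "A = P ** D ** matrix_inv P"
    by (metis matrix_mul_assoc matrix_inv_props(1)[OF P] matrix_mul_rid)
  then show "diagonalizable_matrix A"
    unfolding diagonalizable_matrix_def using P by (intro exI[of _ P] exI[of _ D]) (simp add: D_def)
qed

text \<open>If \<open>v\<close> is an eigenvector of \<open>A\<close>, then \<open>P v\<close> and \<open>v - P v\<close> are (possibly zero) eigenvectors of the
  product, and their sum is \<open>v\<close>.\<close>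
lemma diagonalizable_matrix_mult_idempotent:
  fixes A P :: "complex^'n^'n"
  assumes A: "diagonalizable_matrix A" and P: "P ** P = P" "A ** P = P ** A"
  shows "diagonalizable_matrix (A ** (mat 1 + mat t ** P))"
proof -
  let ?D = "A ** (mat 1 + mat t ** P)"
  let ?E = "{v. \<exists>c. ?D *v v = c *s v}"
  have D: "?D *v v = A *v v + t *s (A *v (P *v v))" for v
    by (simp add: matrix_vector_mul_assoc[symmetric] matrix_vector_mult_add_rdistrib mat_vector_mult
        matrix_vector_right_distrib vec.scale)
  have "v \<in> vec.span ?E" if v: "A *v v = c *s v" for v c
  proof -
    have APv: "A *v (P *v v) = c *s (P *v v)"
      by (simp add: matrix_vector_mul_assoc P) (simp add: matrix_vector_mul_assoc[symmetric] v vec.scale)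
    have PPv: "P *v (P *v v) = P *v v" by (simp add: matrix_vector_mul_assoc P)
    have "?D *v (P *v v) = (c + t * c) *s (P *v v)"
      unfolding D PPv APv by (simp add: vec.scale_left_distrib)
    moreover have "?D *v (v - P *v v) = c *s (v - P *v v)"
      unfolding D by (simp add: vec.diff PPv APv v vec.scale_right_diff_distrib)
    ultimately have "P *v v \<in> ?E" "v - P *v v \<in> ?E" by blast+
    then have "P *v v + (v - P *v v) \<in> vec.span ?E" by (intro vec.span_add vec.span_base)
    then show ?thesis by simp
  qed
  then have "{v. \<exists>c. A *v v = c *s v} \<subseteq> vec.span ?E" by blast
  then have "vec.span {v. \<exists>c. A *v v = c *s v} \<subseteq> vec.span ?E"
    by (simp add: vec.span_minimal)
  then show ?thesis using A unfolding diagonalizable_matrix_iff by blast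
qed

text \<open>If \<open>g\<close> is a linear right inverse of \<open>T\<close> on its range, then \<open>1 - g T\<close> is a projection onto the
  kernel of \<open>T\<close>.\<close>
lemma ex_projection_kernel:
  fixes T :: "complex^'n^'n"
  obtains P where "T ** P = 0" "\<And>v. T *v v = 0 \<Longrightarrow> P *v v = v"
proof -
  obtain g where g: "Vector_Spaces.linear (*s) (*s) g" "\<forall>v\<in>range ((*v) T). T *v (g v) = v"
    using vec.linear_exists_right_inverse_on[of "(*v) T" UNIV] vec.linear_axioms vec.subspace_UNIV by blast
  define P where "P = mat 1 - matrix g ** T"
  have gm: "matrix g *v v = g v" for v by (rule matrix_works[OF g(1)])
  have Pv: "P *v v = v - g (T *v v)" for v
    unfolding P_def by (simp add: matrix_vector_mult_diff_rdistrib gm flip: matrix_vector_mul_assoc)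
  have "T ** P = 0"
    by (rule matrix_eqI_vec) (use g(2) in \<open>simp add: matrix_vector_mul_assoc[symmetric] Pv vec.diff\<close>)
  moreover have "P *v v = v" if "T *v v = 0" for v
    using that gm[of 0] by (simp add: Pv)
  ultimately show ?thesis using that by blast
qed

lemma matrix_inv_cancel:
  fixes A T :: "complex^'n^'n"
  assumes "invertible A"
  shows "matrix_inv A ** (A ** T) = T" "A ** (matrix_inv A ** T) = T"
    "T ** A ** matrix_inv A = T" "T ** matrix_inv A ** A = T"
  using matrix_inv_props[OF assms] by (simp_all add: matrix_mul_assoc) (simp_all add: matrix_mul_assoc[symmetric])

section \<open>Maximality: the lifts of K act irreducibly\<close>

text \<open>The image of an invertible matrix in \<open>PGL\<close>, as a set of matrices.\<close>
definition pgl_class :: "complex^'n^'n \<Rightarrow> (complex^'n^'n) set" where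
  "pgl_class A = {mat c ** A | c. c \<noteq> 0}"

lemma pgl_class_eq_coset: "invertible A \<Longrightarrow> pgl_class A = scalars #>\<^bsub>GL\<^esub> A"
  by (auto simp: pgl_class_def r_coset_def scalars_def GL_def)

lemma mem_pgl_class: "A \<in> pgl_class A"
  unfolding pgl_class_def by (auto intro: exI[of _ 1])

lemma pgl_class_carrier: "invertible A \<Longrightarrow> pgl_class A \<in> carrier PGL"
  by (auto simp: PGL_def FactGroup_def RCOSETS_def pgl_class_eq_coset GL_def)

lemma pgl_class_of_mem: "\<sigma> \<in> carrier PGL \<Longrightarrow> A \<in> \<sigma> \<Longrightarrow> \<sigma> = pgl_class A"
  using PGL_elem(2) unfolding pgl_class_def by blast

lemma PGL_nonempty: "\<sigma> \<in> carrier PGL \<Longrightarrow> \<exists>A. A \<in> \<sigma>"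
  unfolding PGL_def FactGroup_def RCOSETS_def
  using pgl_class_eq_coset mem_pgl_class by (fastforce simp: GL_def)

lemma pgl_class_mult:
  fixes A B :: "complex^'n^'n"
  assumes "invertible A" "invertible B"
  shows "pgl_class A \<otimes>\<^bsub>PGL\<^esub> pgl_class B = pgl_class (A ** B)"
proof -
  interpret group "PGL :: (complex^'n^'n) set monoid" by (rule group_PGL)
  have "A ** B \<in> pgl_class A \<otimes>\<^bsub>PGL\<^esub> pgl_class B"
    by (rule PGL_mult_mem) (rule mem_pgl_class)+
  then show ?thesis using pgl_class_of_mem m_closed assms pgl_class_carrier by blast
qed

lemma pgl_class_scale: "c \<noteq> 0 \<Longrightarrow> pgl_class (mat c ** A) = pgl_class A"
proof -
  assume c: "c \<noteq> 0"
  have eq: "mat d ** (mat c ** A) = mat (d * c) ** A" for d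
    by (simp add: matrix_mul_assoc mat_mult_mat)
  have "\<exists>e. mat d ** (mat c ** A) = mat e ** A \<and> e \<noteq> 0" if "d \<noteq> 0" for d
    using that c eq[of d] by (intro exI[of _ "d * c"]) simp
  moreover have "\<exists>e. mat d ** A = mat e ** (mat c ** A) \<and> e \<noteq> 0" if "d \<noteq> 0" for d
    using that c eq[of "d / c"] by (intro exI[of _ "d / c"]) simp
  ultimately show ?thesis unfolding pgl_class_def by blast
qed

lemma pgl_class_one: "pgl_class (mat 1) = \<one>\<^bsub>PGL\<^esub>"
  by (auto simp: pgl_class_def PGL_def FactGroup_def scalars_def)

lemma invertible_matrix_inv: "invertible A \<Longrightarrow> invertible (matrix_inv (A :: complex^'n^'n))"
  using matrix_inv_props unfolding invertible_def by blast

lemma pgl_class_inv: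
  fixes A :: "complex^'n^'n"
  assumes "invertible A" shows "inv\<^bsub>PGL\<^esub> (pgl_class A) = pgl_class (matrix_inv A)"
proof -
  interpret group "PGL :: (complex^'n^'n) set monoid" by (rule group_PGL)
  show ?thesis
    by (rule inv_equality)
      (simp_all add: pgl_class_mult assms invertible_matrix_inv pgl_class_carrier matrix_inv_props pgl_class_one)
qed

lemma mat_inj: "(mat c :: complex^'n^'n) = mat d \<longleftrightarrow> c = d"
proof
  assume "(mat c :: complex^'n^'n) = mat d"
  from arg_cong[OF this, of "\<lambda>M. M $ undefined $ undefined"] show "c = d" by (simp add: mat_def)
qed simp

lemma not_invertible_0: "\<not> invertible (0 :: complex^'n^'n)"
proof
  assume "invertible (0 :: complex^'n^'n)"
  then have "(mat 0 :: complex^'n^'n) = mat 1" unfolding invertible_def by simp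
  then show False unfolding mat_inj by simp
qed

lemma matrix_inv_unique:
  fixes A B :: "complex^'n^'n"
  assumes "A ** B = mat 1" shows "matrix_inv A = B"
proof -
  have inv: "invertible A" using assms invertible_right_inverse by blast
  have "matrix_inv A ** (A ** B) = matrix_inv A" using assms by simp
  then show ?thesis by (simp add: matrix_inv_cancel[OF inv])
qed

lemma matrix_mult_diff_left: "(A - B) ** C = A ** C - B ** (C :: complex^'n^'n)"
  by (simp add: vec_eq_iff matrix_matrix_mult_def left_diff_distrib sum_subtractf)

lemma matrix_mult_diff_right: "C ** (A - B) = C ** A - C ** (B :: complex^'n^'n)"
  by (simp add: vec_eq_iff matrix_matrix_mult_def right_diff_distrib sum_subtractf)

lemma scale_eq_iff:
  assumes "invertible (A :: complex^'n^'n)" shows "mat c ** A = mat d ** A \<longleftrightarrow> c = d"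
proof
  assume "mat c ** A = mat d ** A"
  then have "mat c ** A ** matrix_inv A = mat d ** A ** matrix_inv A" by simp
  then show "c = d" by (simp add: matrix_inv_cancel[OF assms] mat_inj)
qed simp

lemma scale_mult_swap:
  fixes M N :: "complex^'n^'n"
  shows "(mat e ** M) ** (mat f ** N) = mat (e * f) ** (M ** N)"
proof -
  have "(mat e ** M) ** (mat f ** N) = mat e ** (M ** mat f) ** N"
    by (simp only: matrix_mul_assoc)
  also have "\<dots> = mat e ** (mat f ** M) ** N" by (simp only: mat_commute[of f M])
  also have "\<dots> = (mat e ** mat f) ** (M ** N)" by (simp only: matrix_mul_assoc)
  finally show ?thesis by (simp only: mat_mult_mat)
qed

lemma scale_mult_right: "(M :: complex^'n^'n) ** (mat f ** N) = mat f ** (M ** (N :: complex^'n^'n))"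
  using scale_mult_swap[of 1 M f N] by simp

lemma scale_mult_left: "(mat f ** M) ** N = mat f ** ((M :: complex^'n^'n) ** (N :: complex^'n^'n))"
  using scale_mult_swap[of f M 1 N] by simp

locale finite_maximal_diagonalizable =
  fixes K :: "(complex^'n^'n) set set"
  assumes maximal: "maximal_diagonalizable_subgroup K" and finite_K: "finite K"
begin

lemma subgroup_K: "subgroup K PGL"
  using maximal by (simp add: maximal_diagonalizable_subgroup_def diagonalizable_subgroup_def)

lemma K_carrier: "\<sigma> \<in> K \<Longrightarrow> \<sigma> \<in> carrier PGL"
  using subgroup.subset[OF subgroup_K] by blast

lemma K_commute: "\<sigma> \<in> K \<Longrightarrow> \<tau> \<in> K \<Longrightarrow> \<sigma> \<otimes>\<^bsub>PGL\<^esub> \<tau> = \<tau> \<otimes>\<^bsub>PGL\<^esub> \<sigma>"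
  using maximal by (simp add: maximal_diagonalizable_subgroup_def diagonalizable_subgroup_def)

lemma lift_invertible: "A \<in> \<Union>K \<Longrightarrow> invertible A"
  using PGL_elem(1) K_carrier by blast

lemma lift_diagonalizable: "A \<in> \<Union>K \<Longrightarrow> diagonalizable_matrix A"
  using maximal unfolding maximal_diagonalizable_subgroup_def diagonalizable_subgroup_def semisimple_def by blast

lemma mem_lift_iff: "invertible A \<Longrightarrow> A \<in> \<Union>K \<longleftrightarrow> pgl_class A \<in> K"
  using pgl_class_of_mem K_carrier mem_pgl_class by blast

lemma lift_mult: "A \<in> \<Union>K \<Longrightarrow> B \<in> \<Union>K \<Longrightarrow> A ** B \<in> \<Union>K"
  using PGL_mult_mem subgroup.m_closed[OF subgroup_K] by blast

lemma lift_inv: "A \<in> \<Union>K \<Longrightarrow> matrix_inv A \<in> \<Union>K"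
  using subgroup.m_inv_closed[OF subgroup_K, of "pgl_class A"] mem_lift_iff[of A] mem_lift_iff[of "matrix_inv A"]
    lift_invertible[of A] invertible_matrix_inv[of A] pgl_class_inv[of A] by metis

lemma lift_mat: "c \<noteq> 0 \<Longrightarrow> mat c \<in> \<Union>K"
  using subgroup.one_closed[OF subgroup_K] pgl_class_scale[of c "mat 1"] mem_lift_iff[OF invertible_mat]
  by (metis matrix_mul_rid pgl_class_one)

lemma lift_commute:
  assumes "\<sigma> \<in> K" "\<tau> \<in> K" "A \<in> \<sigma>" "B \<in> \<tau>"
  shows "A ** B = mat (pairing \<sigma> \<tau>) ** (B ** A)"
proof -
  have inv: "invertible A" "invertible B" using assms lift_invertible by blast+
  have "A ** B ** matrix_inv A ** matrix_inv B = mat (pairing \<sigma> \<tau>)"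
    using pairing_eq assms K_carrier K_commute by blast
  then have "(A ** B ** matrix_inv A ** matrix_inv B) ** (B ** A) = mat (pairing \<sigma> \<tau>) ** (B ** A)" by simp
  then show ?thesis by (simp add: matrix_mul_assoc matrix_inv_cancel inv)
qed

lemma pairing_eqI:
  assumes "\<sigma> \<in> K" "\<tau> \<in> K" "A \<in> \<sigma>" "B \<in> \<tau>" "A ** B = mat c ** (B ** A)"
  shows "pairing \<sigma> \<tau> = c"
proof -
  have "invertible (B ** A)" using assms lift_invertible invertible_mult by blast
  then show ?thesis using lift_commute[OF assms(1-4)] assms(5) scale_eq_iff by metis
qed

lemma pairing_nonzero: 
  assumes "\<sigma> \<in> K" "\<tau> \<in> K" shows "pairing \<sigma> \<tau> \<noteq> 0"
proof
  assume 0: "pairing \<sigma> \<tau> = 0"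
  obtain A B where AB: "A \<in> \<sigma>" "B \<in> \<tau>" using PGL_nonempty K_carrier assms by blast
  then have "A ** B = 0" using lift_commute[OF assms AB] 0 by simp
  moreover have "invertible (A ** B)" using AB assms lift_invertible invertible_mult by blast
  ultimately show False by (simp add: not_invertible_0)
qed

lemma lift_commute_ex:
  assumes "A \<in> \<Union>K" "B \<in> \<Union>K" obtains c where "c \<noteq> 0" "A ** B = mat c ** (B ** A)"
  using assms lift_commute pairing_nonzero by blast

text \<open>Maximality of \<open>K\<close> expressed in \<open>GL\<close>. As \<open>L\<close> contains the nonzero scalars, its image in \<open>PGL\<close> is a
  diagonalizable subgroup containing \<open>K\<close>.\<close>
lemma maximality_lift:
  assumes sub: "\<Union>K \<subseteq> L"
    and inv: "\<And>M. M \<in> L \<Longrightarrow> invertible M"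
    and mult: "\<And>M N. M \<in> L \<Longrightarrow> N \<in> L \<Longrightarrow> M ** N \<in> L"
    and minv: "\<And>M. M \<in> L \<Longrightarrow> matrix_inv M \<in> L"
    and diag: "\<And>M. M \<in> L \<Longrightarrow> diagonalizable_matrix M"
    and comm: "\<And>M N. M \<in> L \<Longrightarrow> N \<in> L \<Longrightarrow> \<exists>c. c \<noteq> 0 \<and> M ** N = mat c ** (N ** M)"
  shows "L \<subseteq> \<Union>K"
proof -
  interpret G: group "PGL :: (complex^'n^'n) set monoid" by (rule group_PGL)
  have "subgroup (pgl_class ` L) PGL"
  proof (rule G.subgroupI)
    show "pgl_class ` L \<subseteq> carrier PGL" using inv pgl_class_carrier by blast
    show "pgl_class ` L \<noteq> {}" using sub lift_mat[OF one_neq_zero] by blast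
  next
    fix a assume "a \<in> pgl_class ` L"
    then show "inv\<^bsub>PGL\<^esub> a \<in> pgl_class ` L" using inv minv by (auto simp: pgl_class_inv)
  next
    fix a b assume "a \<in> pgl_class ` L" "b \<in> pgl_class ` L"
    then show "a \<otimes>\<^bsub>PGL\<^esub> b \<in> pgl_class ` L" using inv mult by (auto simp: pgl_class_mult)
  qed
  moreover have "a \<otimes>\<^bsub>PGL\<^esub> b = b \<otimes>\<^bsub>PGL\<^esub> a" if ab: "a \<in> pgl_class ` L" "b \<in> pgl_class ` L" for a b
  proof -
    obtain M N where MN: "M \<in> L" "N \<in> L" "a = pgl_class M" "b = pgl_class N" using ab by blast
    obtain c where "c \<noteq> 0" "M ** N = mat c ** (N ** M)" using comm MN by blast
    then have "pgl_class (M ** N) = pgl_class (N ** M)" using pgl_class_scale by simp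
    then show ?thesis using MN inv by (simp add: pgl_class_mult)
  qed
  moreover have "semisimple (pgl_class M)" if M: "M \<in> L" for M
  proof -
    have "diagonalizable_matrix (mat c ** M)" if "c \<noteq> 0" for c
    proof -
      have "mat c \<in> L" using lift_mat[OF that] sub by (rule rev_subsetD)
      then show ?thesis using M by (intro diag mult)
    qed
    then show ?thesis unfolding semisimple_def pgl_class_def by auto
  qed
  ultimately have "diagonalizable_subgroup (pgl_class ` L)"
    unfolding diagonalizable_subgroup_def by blast
  moreover have "K \<subseteq> pgl_class ` L"
  proof
    fix \<sigma> assume s: "\<sigma> \<in> K"
    then obtain A where "A \<in> \<sigma>" using PGL_nonempty K_carrier by blast
    then show "\<sigma> \<in> pgl_class ` L" using s sub pgl_class_of_mem K_carrier by blast
  qed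
  ultimately have "pgl_class ` L = K"
    using maximal unfolding maximal_diagonalizable_subgroup_def by blast
  then show ?thesis using mem_pgl_class by blast
qed

text \<open>The matrices \<open>D t = 1 + t P\<close> with \<open>t \<noteq> -1\<close> form a commutative group under multiplication and commute with
  the lifts, so they are lifts themselves by maximality. Because \<open>K\<close> is finite,
  \<open>D s = c D t\<close> for some \<open>s \<noteq> t\<close>. If \<open>c = 1\<close>, then \<open>P = 0\<close>; otherwise multiplying by \<open>1 - P\<close> gives
  \<open>1 - P = c (1 - P)\<close>, so \<open>P = 1\<close>.\<close>
lemma idempotent_trivial:
  assumes P: "P ** P = P" and comm: "\<And>A. A \<in> \<Union>K \<Longrightarrow> A ** P = P ** A"
  shows "P = 0 \<or> P = mat 1"
proof -
  define D where "D t = mat 1 + mat t ** P" for t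
  have DD: "D s ** D t = D (s + t + s * t)" for s t
    unfolding D_def
    by (simp add: matrix_add_ldistrib matrix_mult_add_left scale_mult_swap P)
      (simp add: vec_eq_iff mat_mult_nth algebra_simps)
  have D0: "D 0 = mat 1" unfolding D_def by simp
  have AD: "A ** D t = D t ** A" if "A \<in> \<Union>K" for A t
    unfolding D_def using comm[OF that]
    by (simp add: matrix_add_ldistrib matrix_mult_add_left scale_mult_right scale_mult_left)
  \<comment> \<open>From \<open>D s D t = D (s + t + s t)\<close>, solving \<open>s + t + s t = 0\<close> for \<open>s\<close>.\<close>
  have Dinv: "D t ** D (- t / (1 + t)) = mat 1" "D (- t / (1 + t)) ** D t = mat 1" if "t \<noteq> -1" for t
  proof -
    have "1 + t \<noteq> 0" using that by (simp add: add_eq_0_iff)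
    then have "t + - t / (1 + t) + t * (- t / (1 + t)) = 0" "- t / (1 + t) + t + - t / (1 + t) * t = 0"
      by (simp_all add: field_simps)
    then show "D t ** D (- t / (1 + t)) = mat 1" "D (- t / (1 + t)) ** D t = mat 1"
      by (simp_all only: DD D0)
  qed
  define L where "L = {A ** D t | A t. A \<in> \<Union>K \<and> t \<noteq> -1}"
  have swap: "(A ** D s) ** (B ** D t) = (A ** B) ** D (s + t + s * t)" if "A \<in> \<Union>K" "B \<in> \<Union>K" for A B s t
  proof -
    have "(A ** D s) ** (B ** D t) = A ** (D s ** B) ** D t" by (simp only: matrix_mul_assoc)
    also have "\<dots> = (A ** B) ** (D s ** D t)" using that by (simp only: AD[symmetric]) (simp only: matrix_mul_assoc)
    finally show ?thesis by (simp only: DD)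
  qed
  have m1: "s + t + s * t \<noteq> -1" if "s \<noteq> -1" "t \<noteq> -1" for s t :: complex
  proof
    assume "s + t + s * t = -1"
    then have "(s + 1) * (t + 1) = 0" by (simp add: algebra_simps)
    then show False using that by (simp add: add_eq_0_iff2 add_eq_0_iff)
  qed
  have "L \<subseteq> \<Union>K"
  proof (rule maximality_lift)
    have "A \<in> L" if "A \<in> \<Union>K" for A unfolding L_def
      using that D0 by (intro CollectI exI[of _ A] exI[of _ 0]) simp
    then show "\<Union>K \<subseteq> L" by blast
  next
    fix M assume "M \<in> L"
    then obtain A t where M: "M = A ** D t" "A \<in> \<Union>K" "t \<noteq> -1" unfolding L_def by blast
    have Di: "invertible (D t)" using Dinv[OF M(3)] unfolding invertible_def by blast
    show inv: "invertible M" unfolding M using lift_invertible[OF M(2)] Di by (rule invertible_mult)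
    show "diagonalizable_matrix M" unfolding M D_def
      by (rule diagonalizable_matrix_mult_idempotent[OF lift_diagonalizable[OF M(2)] P comm[OF M(2)]])
    have "matrix_inv M = matrix_inv A ** D (- t / (1 + t))"
    proof (rule matrix_inv_unique)
      show "M ** (matrix_inv A ** D (- t / (1 + t))) = mat 1"
        unfolding M swap[OF M(2) lift_inv[OF M(2)]]
        using Dinv(1)[OF M(3)] by (simp add: matrix_inv_props[OF lift_invertible[OF M(2)]] DD)
    qed
    moreover have "- t / (1 + t) \<noteq> -1"
    proof
      assume "- t / (1 + t) = -1"
      moreover have "1 + t \<noteq> 0" using M(3) by (simp add: add_eq_0_iff)
      ultimately show False by (simp add: field_simps)
    qed
    ultimately show "matrix_inv M \<in> L" unfolding L_def using lift_inv[OF M(2)] by blast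
  next
    fix M N assume "M \<in> L" "N \<in> L"
    then obtain A s B t where M: "M = A ** D s" "A \<in> \<Union>K" "s \<noteq> -1" "N = B ** D t" "B \<in> \<Union>K" "t \<noteq> -1"
      unfolding L_def by blast
    show "M ** N \<in> L" unfolding M swap[OF M(2,5)] L_def using lift_mult[OF M(2,5)] m1[OF M(3,6)] by blast
    obtain c where c: "c \<noteq> 0" "A ** B = mat c ** (B ** A)" using lift_commute_ex[OF M(2,5)] .
    have "M ** N = mat c ** (N ** M)"
      unfolding M swap[OF M(2,5)] swap[OF M(5,2)] c
      by (simp add: scale_mult_left add.commute mult.commute)
    then show "\<exists>c. c \<noteq> 0 \<and> M ** N = mat c ** (N ** M)" using c(1) by blast
  qed
  moreover have "D t \<in> L" if "t \<noteq> -1" for t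
    unfolding L_def using that lift_mat[of 1] by (intro CollectI exI[of _ "mat 1"] exI[of _ t]) simp
  ultimately have DK: "D t \<in> \<Union>K" if "t \<noteq> -1" for t using that by blast
  have "(\<lambda>t. pgl_class (D t)) ` (UNIV - {-1}) \<subseteq> K"
    using DK mem_lift_iff lift_invertible by blast
  then have "\<not> inj_on (\<lambda>t. pgl_class (D t)) (UNIV - {-1})"
    using finite_K finite_imageD finite_subset infinite_UNIV_char_0 by (metis finite_Diff_insert Diff_empty)
  then obtain s t where st: "s \<noteq> t" "pgl_class (D s) = pgl_class (D t)" unfolding inj_on_def by blast
  then obtain c where c: "D s = mat c ** D t" using mem_pgl_class[of "D s"] unfolding pgl_class_def by auto
  show ?thesis
  proof (cases "c = 1")
    case True
    have "mat s ** P = mat t ** P" using c True unfolding D_def by simp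
    then have "s * P $ i $ j = t * P $ i $ j" for i j by (metis mat_mult_nth)
    then show ?thesis using st(1) by (simp add: vec_eq_iff)
  next
    case False
    have "(mat 1 - P) ** D u = mat 1 - P" for u
    proof -
      have "P ** D u = P + mat u ** P"
        unfolding D_def by (simp add: matrix_add_ldistrib scale_mult_right P)
      moreover have "(mat 1 - P) ** D u + P ** D u = D u"
        by (simp flip: matrix_mult_add_left)
      ultimately show ?thesis unfolding D_def by (simp add: algebra_simps)
    qed
    from this[of s] this[of t] have "mat 1 - P = mat c ** (mat 1 - P)"
      unfolding c by (simp add: scale_mult_right)
    then have "(mat 1 - P) $ i $ j = c * (mat 1 - P) $ i $ j" for i j by (metis mat_mult_nth)
    then have "(mat 1 - P) $ i $ j = 0" for i j using False by (metis mult_cancel_right1)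
    then have "mat 1 - P = 0" by (simp add: vec_eq_iff)
    then show ?thesis by simp
  qed
qed

definition rep :: "(complex^'n^'n) set \<Rightarrow> complex^'n^'n" where
  "rep \<sigma> = (SOME A. A \<in> \<sigma>)"

lemma rep_mem: "\<sigma> \<in> K \<Longrightarrow> rep \<sigma> \<in> \<sigma>"
  unfolding rep_def using PGL_nonempty K_carrier by (metis someI_ex)

lemma rep_lift: "\<sigma> \<in> K \<Longrightarrow> rep \<sigma> \<in> \<Union>K"
  using rep_mem by blast

text \<open>The Reynolds operator of conjugation by \<open>K\<close>. It does not depend on the representatives \<open>rep\<close>, since scalars cancel
  in a conjugation.\<close>
definition avg :: "complex^'n^'n \<Rightarrow> complex^'n^'n" where
  "avg Z = mat (1 / of_nat (card K)) ** (\<Sum>\<sigma>\<in>K. rep \<sigma> ** Z ** matrix_inv (rep \<sigma>))"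

lemma card_K: "of_nat (card K) \<noteq> (0 :: complex)"
  using finite_K subgroup.one_closed[OF subgroup_K] by auto

lemma conj_same_class:
  assumes "\<sigma> \<in> K" "A \<in> \<sigma>"
  shows "rep \<sigma> ** Z ** matrix_inv (rep \<sigma>) = A ** Z ** matrix_inv A"
proof -
  obtain c where c: "c \<noteq> 0" "rep \<sigma> = mat c ** A"
    using PGL_elem(2)[OF K_carrier[OF assms(1)] assms(2)] rep_mem[OF assms(1)] by blast
  have inv: "invertible A" "invertible (rep \<sigma>)" using assms lift_invertible rep_lift by blast+
  have "rep \<sigma> ** Z = A ** Z ** matrix_inv A ** rep \<sigma>"
    unfolding c by (simp add: scale_mult_left scale_mult_right matrix_inv_cancel[OF inv(1)])
  then show ?thesis by (simp add: matrix_inv_cancel[OF inv(2)])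
qed

lemma avg_commute:
  assumes "B \<in> \<Union>K" shows "B ** avg Z = avg Z ** B"
proof -
  interpret G: group "PGL :: (complex^'n^'n) set monoid" by (rule group_PGL)
  interpret S: subgroup K PGL by (rule subgroup_K)
  obtain \<beta> where b: "\<beta> \<in> K" "B \<in> \<beta>" using assms by blast
  have Bi: "invertible B" using lift_invertible[OF assms] .
  let ?c = "\<lambda>\<sigma>. rep \<sigma> ** Z ** matrix_inv (rep \<sigma>)"
  have "B ** ?c \<sigma> = ?c (\<beta> \<otimes>\<^bsub>PGL\<^esub> \<sigma>) ** B" if s: "\<sigma> \<in> K" for \<sigma>
  proof -
    have inv: "invertible (rep \<sigma>)" using lift_invertible rep_lift s by blast
    have m: "B ** rep \<sigma> \<in> \<beta> \<otimes>\<^bsub>PGL\<^esub> \<sigma>" using PGL_mult_mem b rep_mem s by blast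
    have bs: "\<beta> \<otimes>\<^bsub>PGL\<^esub> \<sigma> \<in> K" using b s by simp
    have "?c (\<beta> \<otimes>\<^bsub>PGL\<^esub> \<sigma>) ** B = (B ** rep \<sigma>) ** Z ** matrix_inv (B ** rep \<sigma>) ** B"
      by (simp only: conj_same_class[OF bs m])
    also have "matrix_inv (B ** rep \<sigma>) = matrix_inv (rep \<sigma>) ** matrix_inv B"
      by (rule matrix_inv_unique) (simp add: matrix_mul_assoc matrix_inv_cancel[OF inv] matrix_inv_props[OF Bi])
    finally show ?thesis by (simp add: matrix_mul_assoc matrix_inv_cancel[OF Bi])
  qed
  then have "(\<Sum>\<sigma>\<in>K. B ** ?c \<sigma>) = (\<Sum>\<sigma>\<in>K. ?c (\<beta> \<otimes>\<^bsub>PGL\<^esub> \<sigma>) ** B)"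
    by (intro sum.cong) auto
  also have "\<dots> = (\<Sum>\<sigma>\<in>K. ?c \<sigma> ** B)"
  proof (rule sum.reindex_bij_witness[of _ "\<lambda>\<sigma>. inv\<^bsub>PGL\<^esub> \<beta> \<otimes>\<^bsub>PGL\<^esub> \<sigma>" "\<lambda>\<sigma>. \<beta> \<otimes>\<^bsub>PGL\<^esub> \<sigma>"])
  qed (use b K_carrier in \<open>auto simp: G.m_assoc[symmetric]\<close>)
  finally show ?thesis
    unfolding avg_def scale_mult_left scale_mult_right
    by (simp only: matrix_mult_sum_distrib_left matrix_mult_sum_distrib_right)
qed

text \<open>Averaging a projection onto the kernel of \<open>Y\<close>, which is invariant under the lifts, gives
  an idempotent \<open>P\<close> with the same range that commutes with the lifts. So the kernel is
  trivial or everything.\<close>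
lemma lift_irreducible:
  fixes Y :: "complex^'n^'n"
  assumes ker: "\<And>A v. A \<in> \<Union>K \<Longrightarrow> Y *v v = 0 \<Longrightarrow> Y *v (A *v v) = 0"
  shows "Y = 0 \<or> invertible Y"
proof -
  obtain Q where Q: "Y ** Q = 0" "\<And>v. Y *v v = 0 \<Longrightarrow> Q *v v = v" using ex_projection_kernel[of Y] by metis
  define P where "P = avg Q"
  have Pv: "P *v v = (1 / of_nat (card K)) *s (\<Sum>\<sigma>\<in>K. rep \<sigma> *v (Q *v (matrix_inv (rep \<sigma>) *v v)))" for v
    unfolding P_def avg_def
    by (simp add: matrix_vector_mul_assoc[symmetric] mat_vector_mult matrix_vector_mult_sum_distrib)
  have YP: "Y *v (P *v v) = 0" for v
  proof -
    have "Y *v (Q *v w) = 0" for w by (simp add: matrix_vector_mul_assoc Q)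
    then have "Y *v (rep \<sigma> *v (Q *v w)) = 0" if "\<sigma> \<in> K" for \<sigma> w using ker rep_lift[OF that] by blast
    then show ?thesis unfolding Pv by (simp add: vec.scale vec.sum)
  qed
  have Pid: "P *v v = v" if "Y *v v = 0" for v
  proof -
    have "rep \<sigma> *v (Q *v (matrix_inv (rep \<sigma>) *v v)) = v" if s: "\<sigma> \<in> K" for \<sigma>
    proof -
      have "Y *v (matrix_inv (rep \<sigma>) *v v) = 0" using ker lift_inv rep_lift s \<open>Y *v v = 0\<close> by blast
      then have "Q *v (matrix_inv (rep \<sigma>) *v v) = matrix_inv (rep \<sigma>) *v v" by (rule Q(2))
      then show ?thesis
        using lift_invertible[OF rep_lift[OF s]] by (simp add: matrix_vector_mul_assoc matrix_inv_props)
    qed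
    then have "P *v v = (1 / of_nat (card K)) *s (\<Sum>\<sigma>\<in>K. v)" unfolding Pv by simp
    also have "\<dots> = v"
    proof -
      have "(\<Sum>\<sigma>\<in>K. v) $ i = of_nat (card K) * v $ i" for i by (subst sum_component) simp
      then show ?thesis using card_K by (simp add: vec_eq_iff del: sum_constant)
    qed
    finally show ?thesis .
  qed
  have "P ** P = P" by (rule matrix_eqI_vec) (simp add: matrix_vector_mul_assoc[symmetric] Pid YP)
  moreover have "A ** P = P ** A" if "A \<in> \<Union>K" for A unfolding P_def using avg_commute[OF that] .
  ultimately consider "P = 0" | "P = mat 1" using idempotent_trivial by blast
  then show ?thesis
  proof cases
    case 1
    then have "\<forall>v. Y *v v = 0 \<longrightarrow> v = 0" using Pid by force
    then show ?thesis using matrix_left_invertible_ker invertible_left_inverse by blast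
  next
    case 2
    then have "Y = 0" using YP by (intro matrix_eqI_vec) simp
    then show ?thesis ..
  qed
qed

text \<open>\<open>Y\<close> minus an eigenvalue also commutes with the lifts and is not invertible, hence it is zero.\<close>
lemma schur:
  assumes "\<And>A. A \<in> \<Union>K \<Longrightarrow> A ** Y = Y ** A"
  obtains c where "Y = mat c"
proof -
  obtain z where z: "\<not> invertible (Y - mat z)" using ex_eigenvalue by blast
  have "(Y - mat z) *v (A *v v) = 0" if "A \<in> \<Union>K" "(Y - mat z) *v v = 0" for A v
  proof -
    have "(Y - mat z) ** A = A ** (Y - mat z)"
      using assms[OF that(1)] by (simp add: matrix_mult_diff_left matrix_mult_diff_right mat_commute)
    then have "(Y - mat z) *v (A *v v) = A *v ((Y - mat z) *v v)"
      by (simp add: matrix_vector_mul_assoc)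
    then show ?thesis using that by simp
  qed
  then have "Y - mat z = 0" using lift_irreducible z by blast
  then show ?thesis using that[of z] by simp
qed

lemma pairing_nondegenerate:
  assumes s: "\<sigma> \<in> K" and one: "\<And>\<tau>. \<tau> \<in> K \<Longrightarrow> pairing \<sigma> \<tau> = 1"
  shows "\<sigma> = \<one>\<^bsub>PGL\<^esub>"
proof -
  obtain A where A: "A \<in> \<sigma>" using PGL_nonempty K_carrier s by blast
  have "B ** A = A ** B" if "B \<in> \<Union>K" for B
    using that lift_commute[OF s _ A] one by force
  then obtain c where c: "A = mat c" using schur by blast
  have "invertible A" using A s lift_invertible by blast
  then have "c \<noteq> 0" using c by (auto simp: not_invertible_0)
  then show ?thesis
    using pgl_class_of_mem[OF K_carrier[OF s] A] pgl_class_scale[of c "mat 1"] c by (simp add: pgl_class_one)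
qed

lemma trace_eq_0_if_commute_up_to_scalar:
  assumes "invertible A" "Y ** A = mat c ** (A ** Y)" "c \<noteq> 1"
  shows "trace (Y :: complex^'n^'n) = 0"
proof -
  have "trace Y = trace (Y ** A ** matrix_inv A)" by (simp add: matrix_inv_cancel[OF assms(1)])
  also have "\<dots> = c * trace (A ** (Y ** matrix_inv A))"
    unfolding assms(2) scale_mult_left trace_mat_mult by (simp only: matrix_mul_assoc)
  also have "trace (A ** (Y ** matrix_inv A)) = trace Y"
    by (subst trace_mul_sym) (simp add: matrix_inv_cancel[OF assms(1)])
  finally show ?thesis using assms(3) by simp
qed

text \<open>Suppose \<open>Y\<close> is not a lift. For a lift \<open>C\<close> the product \<open>Y C\<close> commutes with the lifts up to scalars that are not
  all \<open>1\<close>, since otherwise \<open>Y C\<close> would be scalar by Schur's lemma and \<open>Y\<close> a lift; hence its trace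
  is zero. On the other hand the average of a matrix unit is the scalar matrix with the same trace. Read
  entrywise, this is a Schur orthogonality relation, which expresses \<open>Y\<close> through
  the traces of its products with the lifts. So \<open>Y = 0\<close>.\<close>
lemma self_centralizing:
  assumes inv: "invertible Y" and comm: "\<And>A. A \<in> \<Union>K \<Longrightarrow> \<exists>c. Y ** A = mat c ** (A ** Y)"
  shows "Y \<in> \<Union>K"
proof (rule ccontr)
  assume notin: "Y \<notin> \<Union>K"
  have tr: "trace (Y ** C) = 0" if C: "C \<in> \<Union>K" for C
  proof (rule ccontr)
    assume tr: "trace (Y ** C) \<noteq> 0"
    have "A ** (Y ** C) = (Y ** C) ** A" if A: "A \<in> \<Union>K" for A
    proof -
      obtain c where c: "Y ** A = mat c ** (A ** Y)" using comm A by blast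
      obtain d where d: "C ** A = mat d ** (A ** C)" using lift_commute_ex C A by blast
      have "(Y ** C) ** A = Y ** (C ** A)" by (simp only: matrix_mul_assoc)
      also have "\<dots> = mat d ** ((Y ** A) ** C)" unfolding d scale_mult_right by (simp only: matrix_mul_assoc)
      also have "\<dots> = mat d ** mat c ** (A ** (Y ** C))"
        unfolding c scale_mult_left by (simp only: matrix_mul_assoc)
      finally have e: "(Y ** C) ** A = mat (d * c) ** (A ** (Y ** C))" by (simp only: mat_mult_mat)
      then have "d * c = 1" using trace_eq_0_if_commute_up_to_scalar[OF lift_invertible[OF A]] tr by blast
      then show ?thesis using e by simp
    qed
    then obtain c where c: "Y ** C = mat c" using schur by blast
    then have "c \<noteq> 0" using tr by (auto simp: trace_def)
    then have "mat c ** matrix_inv C \<in> \<Union>K" using C lift_mat lift_mult lift_inv by blast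
    moreover have "mat c ** matrix_inv C = Y"
      unfolding c[symmetric] using matrix_inv_cancel[OF lift_invertible[OF C]] by simp
    ultimately show False using notin by simp
  qed
  have orthogonality: "(\<Sum>\<sigma>\<in>K. rep \<sigma> $ p $ i * matrix_inv (rep \<sigma>) $ j $ q) =
      (if i = j \<and> p = q then of_nat (card K) / of_nat CARD('n) else 0)" for p i j q
  proof -
    define E :: "complex^'n^'n" where "E = (\<chi> a b. if a = i \<and> b = j then 1 else 0)"
    have trE: "trace E = (if i = j then 1 else 0)"
      unfolding trace_def E_def by (simp add: if_distrib sum.delta) (auto intro!: sum.neutral)
    obtain c where c: "avg E = mat c" using schur[of "avg E"] avg_commute by blast
    have "trace (avg E) = trace E"
    proof -
      have "trace (rep \<sigma> ** E ** matrix_inv (rep \<sigma>)) = trace E" if "\<sigma> \<in> K" for \<sigma>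
        using lift_invertible[OF rep_lift[OF that]]
        by (subst trace_mul_sym) (simp add: matrix_mul_assoc matrix_inv_props)
      then show ?thesis unfolding avg_def using card_K by (simp add: trace_mat_mult trace_sum)
    qed
    then have cE: "of_nat CARD('n) * c = (if i = j then 1 else 0)"
      unfolding c trE using trace_mat_mult[of c "mat 1 :: complex^'n^'n"] by (simp add: trace_I mult.commute)
    have ent: "(rep \<sigma> ** E ** matrix_inv (rep \<sigma>)) $ p $ q = rep \<sigma> $ p $ i * matrix_inv (rep \<sigma>) $ j $ q" for \<sigma>
    proof -
      have "(rep \<sigma> ** E) $ p $ b = (if b = j then rep \<sigma> $ p $ i else 0)" for b
      proof -
        have "(rep \<sigma> ** E) $ p $ b = (\<Sum>k\<in>UNIV. if k = i then (if b = j then rep \<sigma> $ p $ k else 0) else 0)"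
          unfolding matrix_matrix_mult_def E_def vec_lambda_beta by (rule sum.cong) auto
        then show ?thesis by simp
      qed
      then have "(rep \<sigma> ** E ** matrix_inv (rep \<sigma>)) $ p $ q =
          (\<Sum>k\<in>UNIV. if k = j then rep \<sigma> $ p $ i * matrix_inv (rep \<sigma>) $ k $ q else 0)"
        unfolding matrix_matrix_mult_def[of "rep \<sigma> ** E"] vec_lambda_beta by (intro sum.cong) auto
      then show ?thesis by simp
    qed
    have "avg E $ p $ q = 1 / of_nat (card K) * (\<Sum>\<sigma>\<in>K. rep \<sigma> $ p $ i * matrix_inv (rep \<sigma>) $ j $ q)"
      unfolding avg_def mat_mult_nth by (simp add: ent)
    then have "(\<Sum>\<sigma>\<in>K. rep \<sigma> $ p $ i * matrix_inv (rep \<sigma>) $ j $ q) = of_nat (card K) * (mat c :: complex^'n^'n) $ p $ q"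
      using card_K unfolding c by simp
    moreover have "c = (if i = j then 1 / of_nat CARD('n) else 0)" using cE by (auto simp: field_simps)
    ultimately show ?thesis by (auto simp: mat_def)
  qed
  have "Y $ p $ i = 0" for p i
  proof -
    have "0 = (\<Sum>\<sigma>\<in>K. rep \<sigma> $ p $ i * trace (Y ** matrix_inv (rep \<sigma>)))"
      using tr lift_inv rep_lift by simp
    also have "\<dots> = (\<Sum>\<sigma>\<in>K. \<Sum>a\<in>UNIV. \<Sum>j\<in>UNIV. Y $ a $ j * (rep \<sigma> $ p $ i * matrix_inv (rep \<sigma>) $ j $ a))"
      by (simp add: trace_def matrix_matrix_mult_def sum_distrib_left mult_ac)
    also have "\<dots> = (\<Sum>a\<in>UNIV. \<Sum>j\<in>UNIV. Y $ a $ j * (\<Sum>\<sigma>\<in>K. rep \<sigma> $ p $ i * matrix_inv (rep \<sigma>) $ j $ a))"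
      unfolding sum_distrib_left by (subst sum.swap, rule sum.cong, simp, rule sum.swap)
    also have "\<dots> = (\<Sum>a\<in>UNIV. \<Sum>j\<in>UNIV. if j = i then (if a = p then Y $ p $ i * (of_nat (card K) / of_nat CARD('n)) else 0) else 0)"
      unfolding orthogonality by (intro sum.cong refl) auto
    also have "\<dots> = Y $ p $ i * (of_nat (card K) / of_nat CARD('n))" by simp
    finally show ?thesis using card_K by simp
  qed
  then have "Y = 0" by (simp add: vec_eq_iff)
  then show False using inv by (simp add: not_invertible_0)
qed

end

section \<open>The Weyl group acts faithfully and isometrically\<close>

lemma (in group) ord_consistent: "group.ord (G\<lparr>carrier := H\<rparr>) x = ord x" if "subgroup H G"
proof -
  interpret H: group "G\<lparr>carrier := H\<rparr>" by (rule subgroup_imp_group[OF that])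
  show ?thesis unfolding H.ord_def ord_def by (simp flip: nat_pow_consistent)
qed

context finite_maximal_diagonalizable
begin

sublocale S: symplectic_group "PGL_sub K" pairing
proof -
  interpret G: group "PGL :: (complex^'n^'n) set monoid" by (rule group_PGL)
  interpret K: group "PGL_sub K" by (rule G.subgroup_imp_group[OF subgroup_K])
  have "comm_group (PGL_sub K)" by (rule K.group_comm_groupI) (simp add: K_commute)
  then interpret K: comm_group "PGL_sub K" .
  show "symplectic_group (PGL_sub K) pairing"
  proof
    show "finite (carrier (PGL_sub K))" using finite_K by simp
  next
    fix x y z assume "x \<in> carrier (PGL_sub K)" "y \<in> carrier (PGL_sub K)" "z \<in> carrier (PGL_sub K)"
    then have K: "x \<in> K" "y \<in> K" "z \<in> K" "x \<otimes>\<^bsub>PGL\<^esub> y \<in> K" "y \<otimes>\<^bsub>PGL\<^esub> z \<in> K"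
      using subgroup.m_closed[OF subgroup_K] by auto
    obtain A B C where lift: "A \<in> x" "B \<in> y" "C \<in> z" using PGL_nonempty K_carrier K by metis
    have "(A ** B) ** C = A ** (B ** C)" by (simp only: matrix_mul_assoc)
    also have "\<dots> = mat (pairing y z) ** ((A ** C) ** B)"
      unfolding lift_commute[OF K(2,3) lift(2,3)] scale_mult_right by (simp only: matrix_mul_assoc)
    also have "\<dots> = mat (pairing y z) ** mat (pairing x z) ** (C ** (A ** B))"
      unfolding lift_commute[OF K(1,3) lift(1,3)] scale_mult_left by (simp only: matrix_mul_assoc)
    finally have "(A ** B) ** C = mat (pairing x z * pairing y z) ** (C ** (A ** B))"
      by (simp only: mat_mult_mat mult.commute)
    from pairing_eqI[OF K(4,3) PGL_mult_mem[OF lift(1,2)] lift(3) this]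
    show "pairing (x \<otimes>\<^bsub>PGL_sub K\<^esub> y) z = pairing x z * pairing y z" by simp
    have "A ** (B ** C) = (A ** B) ** C" by (simp only: matrix_mul_assoc)
    also have "\<dots> = mat (pairing x y) ** (B ** (A ** C))"
      unfolding lift_commute[OF K(1,2) lift(1,2)] scale_mult_left by (simp only: matrix_mul_assoc)
    also have "\<dots> = mat (pairing x y) ** mat (pairing x z) ** ((B ** C) ** A)"
      unfolding lift_commute[OF K(1,3) lift(1,3)] scale_mult_right[of B] by (simp only: matrix_mul_assoc)
    finally have "A ** (B ** C) = mat (pairing x y * pairing x z) ** ((B ** C) ** A)"
      by (simp only: mat_mult_mat)
    from pairing_eqI[OF K(1,5) lift(1) PGL_mult_mem[OF lift(2,3)] this]
    show "pairing x (y \<otimes>\<^bsub>PGL_sub K\<^esub> z) = pairing x y * pairing x z" by simp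
  next
    fix x assume "x \<in> carrier (PGL_sub K)"
    then have x: "x \<in> K" by simp
    then obtain A where A: "A \<in> x" using PGL_nonempty K_carrier by blast
    show "pairing x x = 1" by (rule pairing_eqI[OF x x A A]) simp
  next
    fix x assume x: "x \<in> carrier (PGL_sub K)" "\<And>y. y \<in> carrier (PGL_sub K) \<Longrightarrow> pairing x y = 1"
    have "x = \<one>\<^bsub>PGL\<^esub>" by (rule pairing_nondegenerate) (use x in auto)
    then show "x = \<one>\<^bsub>PGL_sub K\<^esub>" by simp
  qed
qed

lemma isoms_eq_isometries: "S.isoms = isometries K"
  by (simp add: S.isoms_def isometries_def)

lemma transvection_eq_transv:
  assumes "\<sigma> \<in> K" shows "transvection K \<sigma> k = S.transv \<sigma> k"
  using group.ord_consistent[OF group_PGL subgroup_K, of \<sigma>]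
    group.int_pow_consistent[OF group_PGL subgroup_K assms]
  by (simp add: transvection_def S.transv_def)

lemma centralizer_subset:
  assumes y: "y \<in> carrier PGL" and comm: "\<And>\<alpha>. \<alpha> \<in> K \<Longrightarrow> y \<otimes>\<^bsub>PGL\<^esub> \<alpha> = \<alpha> \<otimes>\<^bsub>PGL\<^esub> y"
  shows "y \<in> K"
proof -
  interpret G: group "PGL :: (complex^'n^'n) set monoid" by (rule group_PGL)
  obtain Y where Y: "Y \<in> y" using PGL_nonempty y by blast
  have "Y \<in> \<Union>K"
  proof (rule self_centralizing)
    show "invertible Y" using PGL_elem(1) y Y by blast
    fix A assume "A \<in> \<Union>K"
    then obtain \<alpha> where a: "\<alpha> \<in> K" "A \<in> \<alpha>" by blast
    have "Y ** A \<in> y \<otimes>\<^bsub>PGL\<^esub> \<alpha>" "A ** Y \<in> y \<otimes>\<^bsub>PGL\<^esub> \<alpha>"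
      using PGL_mult_mem[OF Y a(2)] PGL_mult_mem[OF a(2) Y] comm[OF a(1)] by simp_all
    moreover have "y \<otimes>\<^bsub>PGL\<^esub> \<alpha> \<in> carrier PGL" using y a K_carrier by simp
    ultimately show "\<exists>c. Y ** A = mat c ** (A ** Y)" using PGL_elem(2) by blast
  qed
  then show ?thesis using pgl_class_of_mem K_carrier y Y by blast
qed

definition conj_map :: "(complex^'n^'n) set \<Rightarrow> (complex^'n^'n) set \<Rightarrow> (complex^'n^'n) set" where
  "conj_map g = (\<lambda>\<tau>\<in>K. g \<otimes>\<^bsub>PGL\<^esub> \<tau> \<otimes>\<^bsub>PGL\<^esub> inv\<^bsub>PGL\<^esub> g)"

text \<open>Conjugation is injective and \<open>K\<close> is finite, so mapping \<open>K\<close> into itself suffices.\<close>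
lemma normalizer_iff:
  "g \<in> normalizer PGL K \<longleftrightarrow> g \<in> carrier PGL \<and> (\<forall>\<tau>\<in>K. g \<otimes>\<^bsub>PGL\<^esub> \<tau> \<otimes>\<^bsub>PGL\<^esub> inv\<^bsub>PGL\<^esub> g \<in> K)"
proof -
  interpret G: group "PGL :: (complex^'n^'n) set monoid" by (rule group_PGL)
  let ?f = "\<lambda>\<tau>. g \<otimes>\<^bsub>PGL\<^esub> \<tau> \<otimes>\<^bsub>PGL\<^esub> inv\<^bsub>PGL\<^esub> g"
  have eq: "g <#\<^bsub>PGL\<^esub> K #>\<^bsub>PGL\<^esub> inv\<^bsub>PGL\<^esub> g = ?f ` K"
    by (auto simp: l_coset_def r_coset_def)
  have onto: "?f ` K = K" if g: "g \<in> carrier PGL" and sub: "?f ` K \<subseteq> K"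
  proof (rule endo_inj_surj[OF finite_K sub])
    show "inj_on ?f K" using g K_carrier by (auto intro!: inj_onI)
  qed
  have "?f ` K = K \<longleftrightarrow> (\<forall>\<tau>\<in>K. ?f \<tau> \<in> K)" if g: "g \<in> carrier PGL"
  proof
    assume "?f ` K = K"
    then have "?f ` K \<subseteq> K" by simp
    then show "\<forall>\<tau>\<in>K. ?f \<tau> \<in> K" unfolding image_subset_iff .
  next
    assume "\<forall>\<tau>\<in>K. ?f \<tau> \<in> K"
    then show "?f ` K = K" by (intro onto g) (simp only: image_subset_iff)
  qed
  then show ?thesis
    unfolding normalizer_def stabilizer_def using eq subgroup.subset[OF subgroup_K] by (simp cong: conj_cong)
qed

lemma normalizer_carrier: "g \<in> normalizer PGL K \<Longrightarrow> g \<in> carrier PGL"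
  by (simp add: normalizer_iff)

lemma normalizer_subgroup: "subgroup (normalizer PGL K) PGL"
  by (rule group.normalizer_imp_subgroup[OF group_PGL subgroup.subset[OF subgroup_K]])

lemma conj_map_isom:
  assumes g: "g \<in> normalizer PGL K" shows "conj_map g \<in> S.isoms"
proof -
  interpret G: group "PGL :: (complex^'n^'n) set monoid" by (rule group_PGL)
  have gc: "g \<in> carrier PGL" and gK: "\<And>\<tau>. \<tau> \<in> K \<Longrightarrow> g \<otimes>\<^bsub>PGL\<^esub> \<tau> \<otimes>\<^bsub>PGL\<^esub> inv\<^bsub>PGL\<^esub> g \<in> K"
    using g normalizer_iff by auto
  have cancel: "inv\<^bsub>PGL\<^esub> g \<otimes>\<^bsub>PGL\<^esub> (g \<otimes>\<^bsub>PGL\<^esub> z) = z" if "z \<in> carrier PGL" for z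
    using that gc by (simp flip: G.m_assoc)
  have hom: "conj_map g \<in> hom (PGL_sub K) (PGL_sub K)"
  proof (rule homI)
    fix x y assume "x \<in> carrier (PGL_sub K)" "y \<in> carrier (PGL_sub K)"
    then have "x \<in> K" "y \<in> K" "x \<otimes>\<^bsub>PGL\<^esub> y \<in> K" using subgroup.m_closed[OF subgroup_K] by auto
    moreover from this have "g \<otimes>\<^bsub>PGL\<^esub> (x \<otimes>\<^bsub>PGL\<^esub> y) \<otimes>\<^bsub>PGL\<^esub> inv\<^bsub>PGL\<^esub> g =
      (g \<otimes>\<^bsub>PGL\<^esub> x \<otimes>\<^bsub>PGL\<^esub> inv\<^bsub>PGL\<^esub> g) \<otimes>\<^bsub>PGL\<^esub> (g \<otimes>\<^bsub>PGL\<^esub> y \<otimes>\<^bsub>PGL\<^esub> inv\<^bsub>PGL\<^esub> g)"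
      using gc K_carrier by (simp add: G.m_assoc cancel)
    ultimately show "conj_map g (x \<otimes>\<^bsub>PGL_sub K\<^esub> y) = conj_map g x \<otimes>\<^bsub>PGL_sub K\<^esub> conj_map g y"
      by (simp add: conj_map_def)
  qed (simp add: conj_map_def gK)
  obtain M where M: "M \<in> g" using PGL_nonempty gc by blast
  have Mi: "invertible M" using PGL_elem(1) gc M by blast
  have gM: "g = pgl_class M" using pgl_class_of_mem gc M by blast
  have Minv: "matrix_inv M \<in> inv\<^bsub>PGL\<^esub> g" unfolding gM pgl_class_inv[OF Mi] by (rule mem_pgl_class)
  have iso: "pairing (conj_map g x) (conj_map g y) = pairing x y" if xy: "x \<in> K" "y \<in> K" for x y
  proof -
    obtain A B where lift: "A \<in> x" "B \<in> y" using PGL_nonempty K_carrier xy by metis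
    let ?c = "\<lambda>A. M ** A ** matrix_inv M"
    have prod: "?c A ** ?c B = M ** (A ** B) ** matrix_inv M" for A B
      by (simp add: matrix_mul_assoc matrix_inv_cancel[OF Mi])
    have "?c A ** ?c B = mat (pairing x y) ** (?c B ** ?c A)"
      unfolding prod lift_commute[OF xy lift] by (simp add: scale_mult_left scale_mult_right)
    from pairing_eqI[OF gK[OF xy(1)] gK[OF xy(2)] _ _ this]
    show ?thesis using xy M Minv lift by (simp add: conj_map_def PGL_mult_mem)
  qed
  have "conj_map g \<in> extensional K" by (simp add: conj_map_def)
  then show ?thesis
    using hom S.isometric_bij[OF hom] iso by (simp add: S.isoms_def auto_def Bij_def)
qed

lemma carrier_weyl_group: "carrier (weyl_group K) = (\<lambda>g. K #>\<^bsub>PGL\<^esub> g) ` normalizer PGL K"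
  by (auto simp: weyl_group_def FactGroup_def RCOSETS_def r_coset_def)

lemma normal_in_normalizer: "K \<lhd> PGL_sub (normalizer PGL K)"
  by (rule group.subgroup_in_normalizer[OF group_PGL subgroup_K])

text \<open>The choice of a representative of the coset does not matter because \<open>K\<close> is abelian.\<close>
lemma weyl_action_coset:
  assumes g: "g \<in> normalizer PGL K" shows "weyl_action K (K #>\<^bsub>PGL\<^esub> g) = conj_map g"
proof -
  interpret G: group "PGL :: (complex^'n^'n) set monoid" by (rule group_PGL)
  have gc: "g \<in> carrier PGL" using g normalizer_carrier by blast
  have "g \<in> K #>\<^bsub>PGL\<^esub> g"
    using subgroup.one_closed[OF subgroup_K] gc by (force simp: r_coset_def)
  then have "(SOME g'. g' \<in> K #>\<^bsub>PGL\<^esub> g) \<in> K #>\<^bsub>PGL\<^esub> g" by (rule someI)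
  then obtain k where k: "k \<in> K" "(SOME g'. g' \<in> K #>\<^bsub>PGL\<^esub> g) = k \<otimes>\<^bsub>PGL\<^esub> g"
    by (auto simp: r_coset_def)
  have kc: "k \<in> carrier PGL" using k K_carrier by blast
  have "k \<otimes>\<^bsub>PGL\<^esub> g \<otimes>\<^bsub>PGL\<^esub> \<tau> \<otimes>\<^bsub>PGL\<^esub> inv\<^bsub>PGL\<^esub> (k \<otimes>\<^bsub>PGL\<^esub> g) = g \<otimes>\<^bsub>PGL\<^esub> \<tau> \<otimes>\<^bsub>PGL\<^esub> inv\<^bsub>PGL\<^esub> g"
    if t: "\<tau> \<in> K" for \<tau>
  proof -
    have tc: "\<tau> \<in> carrier PGL" using t K_carrier by blast
    let ?u = "g \<otimes>\<^bsub>PGL\<^esub> \<tau> \<otimes>\<^bsub>PGL\<^esub> inv\<^bsub>PGL\<^esub> g"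
    have u: "?u \<in> K" using g t normalizer_iff by blast
    have "k \<otimes>\<^bsub>PGL\<^esub> g \<otimes>\<^bsub>PGL\<^esub> \<tau> \<otimes>\<^bsub>PGL\<^esub> inv\<^bsub>PGL\<^esub> (k \<otimes>\<^bsub>PGL\<^esub> g) = (k \<otimes>\<^bsub>PGL\<^esub> ?u) \<otimes>\<^bsub>PGL\<^esub> inv\<^bsub>PGL\<^esub> k"
      using gc kc tc by (simp add: G.m_assoc G.inv_mult_group)
    also have "\<dots> = (?u \<otimes>\<^bsub>PGL\<^esub> k) \<otimes>\<^bsub>PGL\<^esub> inv\<^bsub>PGL\<^esub> k" using K_commute[OF k(1) u] by simp
    also have "\<dots> = ?u" using gc kc tc by (simp add: G.m_assoc)
    finally show ?thesis .
  qed
  then show ?thesis unfolding weyl_action_def conj_map_def Let_def k(2) by (intro restrict_ext) auto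
qed

lemma conj_map_mult:
  assumes g: "g \<in> normalizer PGL K" and h: "h \<in> normalizer PGL K"
  shows "conj_map (g \<otimes>\<^bsub>PGL\<^esub> h) = compose K (conj_map g) (conj_map h)"
proof -
  interpret G: group "PGL :: (complex^'n^'n) set monoid" by (rule group_PGL)
  have c: "g \<in> carrier PGL" "h \<in> carrier PGL" using g h normalizer_carrier by auto
  have "h \<otimes>\<^bsub>PGL\<^esub> x \<otimes>\<^bsub>PGL\<^esub> inv\<^bsub>PGL\<^esub> h \<in> K" if "x \<in> K" for x using h that normalizer_iff by blast
  then show ?thesis
    unfolding conj_map_def compose_def using c K_carrier
    by (intro restrict_ext) (simp add: G.m_assoc G.inv_mult_group)
qed

lemma weyl_action_mon: "weyl_action K \<in> mon (weyl_group K) (AutoGroup (PGL_sub K))"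
proof -
  interpret G: group "PGL :: (complex^'n^'n) set monoid" by (rule group_PGL)
  interpret N: normal K "PGL_sub (normalizer PGL K)" by (rule normal_in_normalizer)
  have groupW: "group (weyl_group K)" unfolding weyl_group_def by (rule N.factorgroup_is_group)
  have auto: "conj_map g \<in> auto (PGL_sub K)" if "g \<in> normalizer PGL K" for g
    using conj_map_isom[OF that] S.isom_subset_auto by blast
  have hom: "weyl_action K \<in> hom (weyl_group K) (AutoGroup (PGL_sub K))"
  proof (rule homI)
    fix x assume "x \<in> carrier (weyl_group K)"
    then show "weyl_action K x \<in> carrier (AutoGroup (PGL_sub K))"
      using auto by (auto simp: carrier_weyl_group weyl_action_coset S.carrier_AutoGroup)
  next
    fix x y assume "x \<in> carrier (weyl_group K)" "y \<in> carrier (weyl_group K)"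
    then obtain g h where g: "g \<in> normalizer PGL K" "x = K #>\<^bsub>PGL\<^esub> g" and h: "h \<in> normalizer PGL K" "y = K #>\<^bsub>PGL\<^esub> h"
      by (auto simp: carrier_weyl_group)
    have gh: "g \<otimes>\<^bsub>PGL\<^esub> h \<in> normalizer PGL K" using subgroup.m_closed[OF normalizer_subgroup] g h by blast
    have "x \<otimes>\<^bsub>weyl_group K\<^esub> y = K #>\<^bsub>PGL\<^esub> (g \<otimes>\<^bsub>PGL\<^esub> h)"
      using N.rcos_sum[of g h] g h by (simp add: weyl_group_def FactGroup_def set_mult_def r_coset_def)
    then show "weyl_action K (x \<otimes>\<^bsub>weyl_group K\<^esub> y) = weyl_action K x \<otimes>\<^bsub>AutoGroup (PGL_sub K)\<^esub> weyl_action K y"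
      using g h gh by (simp add: weyl_action_coset conj_map_mult S.AutoGroup_mult auto)
  qed
  have "x = \<one>\<^bsub>weyl_group K\<^esub>"
    if x: "x \<in> carrier (weyl_group K)" "weyl_action K x = \<one>\<^bsub>AutoGroup (PGL_sub K)\<^esub>" for x
  proof -
    obtain g where g: "g \<in> normalizer PGL K" "x = K #>\<^bsub>PGL\<^esub> g" using x(1) by (auto simp: carrier_weyl_group)
    have gc: "g \<in> carrier PGL" using g normalizer_carrier by blast
    have id: "conj_map g = (\<lambda>x\<in>K. x)" using x(2) g by (simp add: weyl_action_coset S.one_AutoGroup)
    have "g \<in> K"
    proof (rule centralizer_subset[OF gc])
      fix \<alpha> assume a: "\<alpha> \<in> K"
      then have "g \<otimes>\<^bsub>PGL\<^esub> \<alpha> \<otimes>\<^bsub>PGL\<^esub> inv\<^bsub>PGL\<^esub> g = \<alpha>" using fun_cong[OF id, of \<alpha>] by (simp add: conj_map_def)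
      then have "\<alpha> \<otimes>\<^bsub>PGL\<^esub> g = g \<otimes>\<^bsub>PGL\<^esub> \<alpha> \<otimes>\<^bsub>PGL\<^esub> inv\<^bsub>PGL\<^esub> g \<otimes>\<^bsub>PGL\<^esub> g" by simp
      then show "g \<otimes>\<^bsub>PGL\<^esub> \<alpha> = \<alpha> \<otimes>\<^bsub>PGL\<^esub> g" using a K_carrier gc by (simp add: G.m_assoc)
    qed
    then show ?thesis
      unfolding g(2) using G.coset_join2[OF gc subgroup_K] by (simp add: weyl_group_def FactGroup_def)
  qed
  then have "inj_on (weyl_action K) (carrier (weyl_group K))"
    using inj_on_one_iff'[OF hom groupW S.AutoGroup] by blast
  then show ?thesis using hom by (simp add: mon_def)
qed

end

section \<open>Gauss sums realise transvections\<close>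

lemma scale_scale: "mat a ** (mat b ** A) = mat (a * b) ** (A :: complex^'n^'n)"
  by (simp only: matrix_mul_assoc mat_mult_mat)

lemma GL_pow_Suc: "A [^]\<^bsub>GL\<^esub> Suc r = A [^]\<^bsub>GL\<^esub> r ** (A :: complex^'n^'n)"
  by (simp add: GL_def)

lemma GL_pow_0: "A [^]\<^bsub>GL\<^esub> (0::nat) = (mat 1 :: complex^'n^'n)"
  by (simp add: GL_def)

lemma GL_pow_add: "A [^]\<^bsub>GL\<^esub> (r + s :: nat) = A [^]\<^bsub>GL\<^esub> r ** A [^]\<^bsub>GL\<^esub> s" for A :: "complex^'n^'n"
  by (induction s) (simp_all add: GL_pow_0 GL_pow_Suc matrix_mul_assoc del: nat_pow_Suc nat_pow_0)

lemma GL_pow_scale: "(mat c ** A) [^]\<^bsub>GL\<^esub> (r :: nat) = mat (c ^ r) ** (A [^]\<^bsub>GL\<^esub> r)" for A :: "complex^'n^'n"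
  by (induction r)
    (simp_all add: GL_pow_0 GL_pow_Suc scale_mult_swap mult.commute del: nat_pow_Suc nat_pow_0)

lemma GL_pow_commute:
  fixes A B :: "complex^'n^'n"
  assumes "A ** B = mat z ** (B ** A)"
  shows "A [^]\<^bsub>GL\<^esub> (r::nat) ** B = mat (z ^ r) ** (B ** A [^]\<^bsub>GL\<^esub> r)"
proof (induction r)
  case (Suc r)
  have "A [^]\<^bsub>GL\<^esub> Suc r ** B = A [^]\<^bsub>GL\<^esub> r ** (A ** B)" by (simp only: GL_pow_Suc matrix_mul_assoc)
  also have "\<dots> = mat z ** ((A [^]\<^bsub>GL\<^esub> r ** B) ** A)"
    unfolding assms scale_mult_right by (simp only: matrix_mul_assoc)
  also have "\<dots> = mat z ** mat (z ^ r) ** (B ** (A [^]\<^bsub>GL\<^esub> r ** A))"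
    unfolding Suc scale_mult_left by (simp only: matrix_mul_assoc)
  finally show ?case by (simp only: GL_pow_Suc mat_mult_mat power_Suc)
qed (simp add: GL_def)

lemma sum_periodic_shift:
  fixes f :: "nat \<Rightarrow> 'b::ab_group_add"
  assumes "\<And>r. f (r + m) = f r"
  shows "(\<Sum>r<m. f (r + j)) = (\<Sum>r<m. f r)"
proof (induction j)
  case (Suc j)
  have "(\<Sum>r<Suc m. f (r + j)) = f j + (\<Sum>r<m. f (r + Suc j))"
    by (subst sum.lessThan_Suc_shift) simp
  then have "(\<Sum>r<m. f (r + Suc j)) = (\<Sum>r<m. f (r + j))"
    using assms[of j] by (simp add: add.commute)
  then show ?case using Suc by simp
qed simp

lemma ex_complex_root:
  assumes "c \<noteq> (0::complex)" "m > 0"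
  obtains d where "d ^ m = c"
proof
  have "exp (Ln c / of_nat m) ^ m = exp (of_nat m * (Ln c / of_nat m))"
    by (simp only: exp_of_nat_mult)
  then show "exp (Ln c / of_nat m) ^ m = c" using assms by simp
qed

context finite_maximal_diagonalizable
begin

lemma lift_pow: "\<sigma> \<in> K \<Longrightarrow> A \<in> \<sigma> \<Longrightarrow> A [^]\<^bsub>GL\<^esub> (r::nat) \<in> \<sigma> [^]\<^bsub>PGL\<^esub> r"
proof (induction r)
  case 0
  have "mat 1 \<in> \<one>\<^bsub>PGL\<^esub>" using mem_pgl_class[of "mat 1"] by (simp only: pgl_class_one)
  then show ?case by (simp add: GL_pow_0 del: nat_pow_0) (simp add: PGL_def GL_pow_0)
next
  case (Suc r)
  then show ?case
    using PGL_mult_mem[of "A [^]\<^bsub>GL\<^esub> r" "\<sigma> [^]\<^bsub>PGL\<^esub> r" A \<sigma>] unfolding GL_pow_Suc by simp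
qed

lemma pow_K: "\<sigma> \<in> K \<Longrightarrow> \<sigma> [^]\<^bsub>PGL\<^esub> (r::nat) \<in> K"
  using S.nat_pow_closed[of \<sigma> r] monoid.nat_pow_consistent[OF group.is_monoid[OF group_PGL], of \<sigma> r K] by simp

lemma ex_lift_same_order:
  assumes s: "\<sigma> \<in> K" and m: "\<sigma> [^]\<^bsub>PGL\<^esub> m = \<one>\<^bsub>PGL\<^esub>" "m > 0"
  obtains A where "A \<in> \<sigma>" "A [^]\<^bsub>GL\<^esub> (m::nat) = mat 1"
proof -
  obtain B where B: "B \<in> \<sigma>" using PGL_nonempty K_carrier s by blast
  have "B [^]\<^bsub>GL\<^esub> m \<in> pgl_class (mat 1)" using lift_pow[OF s B, of m] m(1) by (simp only: pgl_class_one)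
  then obtain c where c: "c \<noteq> 0" "B [^]\<^bsub>GL\<^esub> m = mat c" unfolding pgl_class_def by auto
  obtain d where d: "d ^ m = inverse c" using ex_complex_root[of "inverse c" m] c m by auto
  have "d \<noteq> 0" using d c m by (metis inverse_nonzero_iff_nonzero power_eq_0_iff)
  then have "mat d ** B \<in> \<sigma>" using PGL_elem(2)[OF K_carrier[OF s] B] by blast
  moreover have "(mat d ** B) [^]\<^bsub>GL\<^esub> m = mat 1"
    using c by (simp add: GL_pow_scale d mat_mult_mat)
  ultimately show ?thesis using that by blast
qed

text \<open>Nondegeneracy provides a lift with which \<open>A\<close> commutes only up to a scalar different from \<open>1\<close>, and
  conjugating by it multiplies the trace of \<open>A\<close> by that scalar.\<close>
lemma trace_lift_eq_0:
  assumes s: "\<sigma> \<in> K" "\<sigma> \<noteq> \<one>\<^bsub>PGL\<^esub>" and A: "A \<in> \<sigma>"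
  shows "trace A = 0"
proof -
  obtain \<tau> where t: "\<tau> \<in> K" "pairing \<sigma> \<tau> \<noteq> 1" using pairing_nondegenerate s by blast
  obtain B where B: "B \<in> \<tau>" using PGL_nonempty K_carrier t by blast
  show ?thesis
    using trace_eq_0_if_commute_up_to_scalar[OF _ lift_commute[OF s(1) t(1) A B] t(2)] lift_invertible t(1) B by blast
qed

text \<open>Let \<open>A\<close> be a lift of \<open>\<sigma>\<close> with \<open>A\<^sup>m = 1\<close>, let \<open>w = root_unity m\<close>, and let \<open>q r = z\<^bsup>r(r+m)\<^esup>\<close> with \<open>z\<^sup>2 = w\<close>. The
  function \<open>q\<close> satisfies \<open>q (r + j) = q r w\<^bsup>rj\<^esup> q j\<close> and \<open>q m = 1\<close>, so it is periodic with period \<open>m\<close>; the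
  term \<open>r m\<close> in the exponent is what makes this true also for odd \<open>m\<close>. If \<open>A B = w\<^sup>j B A\<close>, then moving \<open>B\<close> to the
  left through \<open>g = \<Sum>\<^sub>r q r A\<^sup>r\<close> multiplies the \<open>r\<close>-th term by \<open>w\<^bsup>rj\<^esup>\<close>, which amounts to shifting the sum by
  \<open>j\<close>. Therefore \<open>g B\<close> equals \<open>B A\<^bsup>-j\<^esup> g\<close> up to a scalar, and conjugation by \<open>g\<close> is the transvection
  along \<open>\<sigma>\<close>. In particular the kernel of \<open>g\<close> is invariant under the lifts, and the trace of \<open>g\<close> is not zero,
  since only the term \<open>r = 0\<close> contributes; so \<open>g\<close> is invertible by irreducibility.\<close>
lemma transvection_in_weyl:
  assumes s: "\<sigma> \<in> K" and s1: "\<sigma> \<noteq> \<one>\<^bsub>PGL\<^esub>"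
  shows "S.transv \<sigma> 1 \<in> conj_map ` normalizer PGL K"
proof -
  interpret G: group "PGL :: (complex^'n^'n) set monoid" by (rule group_PGL)
  define m where "m = group.ord PGL \<sigma>"
  have sc: "\<sigma> \<in> carrier PGL" using s K_carrier by blast
  have ord: "group.ord (PGL_sub K) \<sigma> = m"
    unfolding m_def by (rule G.ord_consistent[OF subgroup_K])
  have m: "m > 0" using S.ord_pos[of \<sigma>] s ord by simp
  have pow1: "\<sigma> [^]\<^bsub>PGL\<^esub> r = \<one>\<^bsub>PGL\<^esub> \<longleftrightarrow> m dvd r" for r :: nat
    unfolding m_def by (rule G.pow_eq_id[OF sc])
  obtain A where A: "A \<in> \<sigma>" "A [^]\<^bsub>GL\<^esub> m = mat 1" using ex_lift_same_order[OF s, of m] pow1 m by auto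
  define z where "z = root_unity (2 * m)"
  define w where "w = root_unity m"
  have zw: "z ^ 2 = w"
  proof -
    have "z ^ 2 = exp (of_nat 2 * (2 * of_real pi * \<i> / of_nat (2 * m)))"
      unfolding z_def root_unity_def by (simp only: exp_of_nat_mult)
    then show ?thesis unfolding w_def root_unity_def by (simp add: mult.assoc)
  qed
  have wm: "w ^ m = 1" using root_unity_powi_eq_1[OF m, of "int m"] by (simp add: w_def)
  have w0: "z \<noteq> 0" by (simp add: z_def)
  define q where "q r = z ^ (r * (r + m))" for r
  have q0: "q r \<noteq> 0" for r by (simp add: q_def w0)
  have q_add: "q (r + j) = q r * w ^ (r * j) * q j" for r j
  proof -
    have "(r + j) * (r + j + m) = r * (r + m) + 2 * (r * j) + j * (j + m)" by (simp only: mult_2 distrib_left distrib_right ac_simps)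
    then show ?thesis
      unfolding q_def zw[symmetric] power_mult[symmetric] power_add[symmetric] by (simp only:)
  qed
  have "q m = (w ^ m) ^ m"
    unfolding q_def zw[symmetric] power_mult[symmetric] by (simp add: mult.commute flip: mult_2)
  then have q_m: "q m = 1" by (simp add: wm)
  define F where "F r = mat (q r) ** A [^]\<^bsub>GL\<^esub> r" for r
  have F_periodic: "F (r + m) = F r" for r
  proof -
    have "w ^ (r * m) = 1" using wm by (metis mult.commute power_mult power_one)
    then show ?thesis unfolding F_def by (simp add: q_add q_m GL_pow_add A)
  qed
  define g where "g = (\<Sum>r<m. F r)"
  have g_mult: "g ** B = mat (1 / q j) ** (B ** matrix_inv (A [^]\<^bsub>GL\<^esub> j) ** g)"
    if AB: "A ** B = mat (w ^ j) ** (B ** A)" for B and j :: nat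
  proof -
    define h where "h = (\<Sum>r<m. mat (q r * w ^ (r * j)) ** A [^]\<^bsub>GL\<^esub> r)"
    have "F r ** B = B ** (mat (q r * w ^ (r * j)) ** A [^]\<^bsub>GL\<^esub> r)" for r
      unfolding F_def scale_mult_left GL_pow_commute[OF AB] scale_mult_right[of B] scale_scale
      by (simp add: power_mult[symmetric] mult.commute[of j])
    then have gB: "g ** B = B ** h"
      unfolding g_def h_def by (simp add: matrix_mult_sum_distrib_left matrix_mult_sum_distrib_right)
    have "mat (q j) ** (A [^]\<^bsub>GL\<^esub> j ** (mat (q r * w ^ (r * j)) ** A [^]\<^bsub>GL\<^esub> r)) = F (r + j)" for r
      unfolding F_def q_add scale_mult_right[of "A [^]\<^bsub>GL\<^esub> j"] GL_pow_add[symmetric] scale_scale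
      by (simp add: mult_ac add.commute)
    then have "mat (q j) ** (A [^]\<^bsub>GL\<^esub> j ** h) = (\<Sum>r<m. F (r + j))"
      unfolding h_def by (simp add: matrix_mult_sum_distrib_right)
    also have "\<dots> = g" unfolding g_def by (rule sum_periodic_shift) (rule F_periodic)
    finally have "mat (q j) ** (A [^]\<^bsub>GL\<^esub> j ** h) = g" .
    moreover have "invertible (A [^]\<^bsub>GL\<^esub> j)" using lift_pow[OF s A(1)] pow_K[OF s] lift_invertible by blast
    ultimately have "mat (1 / q j) ** (matrix_inv (A [^]\<^bsub>GL\<^esub> j) ** g) = mat (1 / q j) ** mat (q j) ** h"
      by (metis matrix_inv_cancel(1) matrix_mul_assoc scale_mult_right)
    then have h: "h = mat (1 / q j) ** (matrix_inv (A [^]\<^bsub>GL\<^esub> j) ** g)" using q0[of j] by (simp add: mat_mult_mat)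
    show ?thesis unfolding gB h scale_mult_right[of B] by (simp only: matrix_mul_assoc)
  qed
  have log: "\<exists>j::nat. pairing \<sigma> \<tau> = w ^ j" if t: "\<tau> \<in> K" for \<tau>
  proof -
    have "\<sigma> \<in> carrier (PGL_sub K)" "\<tau> \<in> carrier (PGL_sub K)" using s t by simp_all
    then obtain i where i: "pairing \<sigma> \<tau> = root_unity m powi i"
      unfolding ord[symmetric] by (rule S.transv_cases)
    define j where "j = nat (i mod int m)"
    have "int m dvd i - int j" using m unfolding j_def by (simp add: mod_eq_dvd_iff[symmetric])
    then have "pairing \<sigma> \<tau> = root_unity m powi int j" unfolding i root_unity_powi_eq_iff[OF m] .
    then show ?thesis unfolding w_def by auto
  qed
  have gi: "invertible g"
  proof -
    have "trace (F r) = (if r = 0 then of_nat CARD('n) else 0)" if "r < m" for r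
    proof (cases "r = 0")
      case True
      then show ?thesis by (simp add: F_def q_def GL_def trace_I)
    next
      case False
      then have "\<not> m dvd r" using that by (auto dest: dvd_imp_le)
      then have "trace (A [^]\<^bsub>GL\<^esub> r) = 0"
        using trace_lift_eq_0[OF pow_K[OF s] _ lift_pow[OF s A(1)]] pow1 by blast
      then show ?thesis using False by (simp add: F_def trace_mat_mult)
    qed
    then have "trace g = of_nat CARD('n)"
      unfolding g_def trace_sum using m by (simp add: sum.delta)
    then have "g \<noteq> 0" by (auto simp: trace_def)
    moreover have "g *v (B *v v) = 0" if B: "B \<in> \<Union>K" and v: "g *v v = 0" for B v
    proof -
      obtain \<tau> where t: "\<tau> \<in> K" "B \<in> \<tau>" using B by blast
      obtain j where "pairing \<sigma> \<tau> = w ^ j" using log t by blast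
      then have "A ** B = mat (w ^ j) ** (B ** A)" using lift_commute[OF s t(1) A(1) t(2)] by simp
      from g_mult[OF this] show ?thesis by (simp add: matrix_vector_mul_assoc) (simp add: matrix_vector_mul_assoc[symmetric] v)
    qed
    ultimately show ?thesis using lift_irreducible by blast
  qed
  define \<gamma> where "\<gamma> = pgl_class g"
  have gc: "\<gamma> \<in> carrier PGL" unfolding \<gamma>_def using gi by (rule pgl_class_carrier)
  have conj: "\<gamma> \<otimes>\<^bsub>PGL\<^esub> \<tau> \<otimes>\<^bsub>PGL\<^esub> inv\<^bsub>PGL\<^esub> \<gamma> = S.transv \<sigma> 1 \<tau>" if t: "\<tau> \<in> K" for \<tau>
  proof -
    obtain B where B: "B \<in> \<tau>" using PGL_nonempty K_carrier t by blast
    obtain j where j: "pairing \<sigma> \<tau> = w ^ j" using log t by blast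
    then have AB: "A ** B = mat (w ^ j) ** (B ** A)" using lift_commute[OF s t A(1) B] by simp
    have Aj: "A [^]\<^bsub>GL\<^esub> j \<in> \<sigma> [^]\<^bsub>PGL\<^esub> j" by (rule lift_pow[OF s A(1)])
    have inv: "invertible B" "invertible (A [^]\<^bsub>GL\<^esub> j)" using t B Aj pow_K[OF s] lift_invertible by blast+
    have \<tau>: "\<tau> = pgl_class B" using pgl_class_of_mem K_carrier t B by blast
    have \<sigma>j: "\<sigma> [^]\<^bsub>PGL\<^esub> j = pgl_class (A [^]\<^bsub>GL\<^esub> j)" using pgl_class_of_mem K_carrier pow_K[OF s] Aj by blast
    have "\<gamma> \<otimes>\<^bsub>PGL\<^esub> \<tau> \<otimes>\<^bsub>PGL\<^esub> inv\<^bsub>PGL\<^esub> \<gamma> = pgl_class (g ** B ** matrix_inv g)"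
      unfolding \<gamma>_def \<tau> by (simp add: pgl_class_inv pgl_class_mult gi inv invertible_mult invertible_matrix_inv)
    also have "g ** B ** matrix_inv g = mat (1 / q j) ** (B ** matrix_inv (A [^]\<^bsub>GL\<^esub> j))"
      unfolding g_mult[OF AB] scale_mult_left by (simp add: matrix_inv_cancel[OF gi])
    also have "pgl_class \<dots> = pgl_class (B ** matrix_inv (A [^]\<^bsub>GL\<^esub> j))"
      using q0 by (simp add: pgl_class_scale)
    also have "\<dots> = \<tau> \<otimes>\<^bsub>PGL\<^esub> inv\<^bsub>PGL\<^esub> (\<sigma> [^]\<^bsub>PGL\<^esub> j)"
      unfolding \<sigma>j \<tau> by (simp add: pgl_class_inv pgl_class_mult inv invertible_matrix_inv)
    also have "inv\<^bsub>PGL\<^esub> (\<sigma> [^]\<^bsub>PGL\<^esub> j) = \<sigma> [^]\<^bsub>PGL_sub K\<^esub> (- 1 * int j)"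
      using G.int_pow_consistent[OF subgroup_K s, of "- 1 * int j"] G.int_pow_neg_int[OF sc, of j] by simp
    also have "\<tau> \<otimes>\<^bsub>PGL\<^esub> \<dots> = S.transv \<sigma> 1 \<tau>"
      using S.transv_eq[of \<sigma> \<tau> "int j" 1] s t j ord by (simp add: w_def)
    finally show ?thesis .
  qed
  have "\<gamma> \<in> normalizer PGL K" unfolding normalizer_iff using gc conj S.transv_closed[of \<sigma>] s by auto
  moreover have "S.transv \<sigma> 1 = conj_map \<gamma>"
    unfolding conj_map_def
    by (rule extensionalityI[of _ K]) (use conj in \<open>auto simp: S.transv_def\<close>)
  ultimately show ?thesis by blast
qed

end

section \<open>The Weyl group is the isometry group\<close>

theorem theorem1p2:
  fixes K :: "(complex^'n^'n) set set"
  assumes "maximal_diagonalizable_subgroup K" and "finite K"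
  shows "weyl_action K \<in> mon (weyl_group K) (AutoGroup (PGL_sub K))
    \<and> weyl_automorphisms K = isometries K
    \<and> generate (AutoGroup (PGL_sub K)) (transvections K \<inter> weyl_automorphisms K)
        = weyl_automorphisms K"
proof -
  interpret finite_maximal_diagonalizable K using assms by unfold_locales
  interpret A: group "AutoGroup (PGL_sub K)" by (rule S.AutoGroup)
  let ?W = "weyl_automorphisms K"
  have W: "?W = conj_map ` normalizer PGL K"
    unfolding weyl_automorphisms_def carrier_weyl_group image_image by (rule image_cong) (simp_all add: weyl_action_coset)
  interpret N: normal K "PGL_sub (normalizer PGL K)" by (rule normal_in_normalizer)
  have "group_hom (weyl_group K) (AutoGroup (PGL_sub K)) (weyl_action K)"
    using weyl_action_mon N.factorgroup_is_group S.AutoGroup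
    by (auto simp: group_hom_def group_hom_axioms_def mon_def weyl_group_def)
  then have subW: "subgroup ?W (AutoGroup (PGL_sub K))"
    unfolding weyl_automorphisms_def by (rule group_hom.img_is_subgroup)
  have tvW: "{S.transv \<sigma> 1 | \<sigma>. \<sigma> \<in> carrier (PGL_sub K) \<and> \<sigma> \<noteq> \<one>\<^bsub>PGL_sub K\<^esub>} \<subseteq> transvections K \<inter> ?W"
  proof clarify
    fix \<sigma> assume s: "\<sigma> \<in> carrier (PGL_sub K)" "\<sigma> \<noteq> \<one>\<^bsub>PGL_sub K\<^esub>"
    then have "transvection K \<sigma> 1 \<in> transvections K" unfolding transvections_def by simp blast
    then have "S.transv \<sigma> 1 \<in> transvections K" using transvection_eq_transv[of \<sigma> 1] s by simp
    moreover have "S.transv \<sigma> 1 \<in> ?W" unfolding W using transvection_in_weyl s by simp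
    ultimately show "S.transv \<sigma> 1 \<in> transvections K \<inter> ?W" by blast
  qed
  then have gen: "S.transv_group \<subseteq> generate (AutoGroup (PGL_sub K)) (transvections K \<inter> ?W)"
    unfolding S.transv_group_def by (rule A.mono_generate)
  moreover have le: "generate (AutoGroup (PGL_sub K)) (transvections K \<inter> ?W) \<subseteq> ?W"
    by (rule A.generate_subgroup_incl[OF _ subW]) simp
  moreover have "?W \<subseteq> S.isoms" unfolding W using conj_map_isom by blast
  ultimately show ?thesis
    using weyl_action_mon S.isoms_eq_transv_group isoms_eq_isometries by blast
qed

end
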